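(* Let $\mathbb K$ be a field of characteristic different from $2$ and let $(\mathfrak g,\pi_1,\pi_2)$ be a compatible pre-Lie algebra over $\mathbb K$. Put $\mathrm d_{\pi_i}=[\pi_i,\cdot]^{MN}$ for $i=1,2$. Then $(C^*(\mathfrak g;\mathfrak g),[\cdot,\cdot]^{MN},\mathrm d_{\pi_1},\mathrm d_{\pi_2})$ is a bidifferential graded Lie algebra. Moreover, for all $\pi_1',\pi_2'\in\mathrm{Hom}(\otimes^2\mathfrak g,\mathfrak g)$, the triple $(\mathfrak g,\pi_1+\pi_1',\pi_2+\pi_2')$ is a compatible pre-Lie algebra if and only if $(\pi_1',\pi_2')$ is a Maurer-Cartan element of the bidifferential graded Lie algebra $(C^*(\mathfrak g;\mathfrak g),[\cdot,\cdot]^{MN},\mathrm d_{\pi_1},\mathrm d_{\pi_2})$.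
   Context: Pre-Lie algebra: a vector space $\mathfrak g$ with a bilinear product $\cdot$ satisfying $(x\cdot y)\cdot z-x\cdot(y\cdot z)=(y\cdot x)\cdot z-y\cdot(x\cdot z)$ for all $x,y,z$. Compatible pre-Lie algebra: a triple $(\mathfrak g,\cdot,\ast)$ where $\cdot$ and $\ast$ are pre-Lie products on $\mathfrak g$ such that for all $x,y,z\in\mathfrak g$: $(x\ast y)\cdot z+(x\cdot y)\ast z-x\cdot(y\ast z)-x\ast(y\cdot z)-(y\ast x)\cdot z-(y\cdot x)\ast z+y\cdot(x\ast z)+y\ast(x\cdot z)=0$. Here $(\mathfrak g,\pi_1,\pi_2)$ means $x\cdot y=\pi_1(x,y)$, $x\ast y=\pi_2(x,y)$. Graded Lie algebra: $C^n(\mathfrak g;\mathfrak g)=\mathrm{Hom}(\wedge^{n-1}\mathfrak g\otimes\mathfrak g,\mathfrak g)$, $C^*(\mathfrak g;\mathfrak g)=\oplus_{n\ge1}C^n(\mathfrak g;\mathfrak g)$, where $C^{p+1}(\mathfrak g;\mathfrak g)$ has degree $p$. The Matsushima-Nijenhuis bracket is $[P,Q]^{MN}=P\circ Q-(-1)^{pq}Q\circ P$ for $P\in C^{p+1}(\mathfrak g;\mathfrak g)$, $Q\in C^{q+1}(\mathfrak g;\mathfrak g)$, where $P\circ Q\in C^{p+q+1}(\mathfrak g;\mathfrak g)$ is $$(P\circ Q)(x_1,\dots,x_{p+q+1})=\sum_{\sigma\in\mathbb S_{(q,1,p-1)}}\mathrm{sgn}(\sigma)P(Q(x_{\sigma(1)},\dots,x_{\sigma(q)},x_{\sigma(q+1)}),x_{\sigma(q+2)},\dots,x_{\sigma(p+q)},x_{p+q+1})$$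 $$+(-1)^{pq}\sum_{\sigma\in\mathbb S_{(p,q)}}\mathrm{sgn}(\sigma)P(x_{\sigma(1)},\dots,x_{\sigma(p)},Q(x_{\sigma(p+1)},\dots,x_{\sigma(p+q)},x_{p+q+1})).$$ Here $\mathbb S_{(i_1,\dots,i_k)}$ is the set of $(i_1,\dots,i_k)$-unshuffles (permutations of $\{1,\dots,i_1+\dots+i_k\}$ increasing on each consecutive block of lengths $i_1,\dots,i_k$); the first sum is empty if $p=0$. It is known that $(C^*(\mathfrak g;\mathfrak g),[\cdot,\cdot]^{MN})$ is a graded Lie algebra. A bidifferential graded Lie algebra $(\mathcal G,[\cdot,\cdot],\mathrm d_1,\mathrm d_2)$ is a graded Lie algebra $\mathcal G=\oplus_{i\ge0}\mathfrak g_i$ with two differentials $\mathrm d_1,\mathrm d_2$, each making it a differential graded Lie algebra, such that $\mathrm d_1\mathrm d_2+\mathrm d_2\mathrm d_1=0$. A pair $(P_1,P_2)\in\mathfrak g_1\oplus\mathfrak g_1$ is a Maurer-Cartan element if $\mathrm d_1P_1+\frac12[P_1,P_1]=0$, $\mathrm d_2P_2+\frac12[P_2,P_2]=0$ and $\mathrm d_1P_2+\mathrm d_2P_1+[P_1,P_2]=0$. *)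

theory Defs
  imports
    Complex_Main
    "HOL-Library.Function_Algebras"
    "HOL-Combinatorics.Permutations"
    "HOL-Computational_Algebra.Computational_Algebra"
begin

section \<open>Compatible pre-Lie algebras\<close>

definition bilinear_product ::
  "('k::field \<Rightarrow> 'g::ab_group_add \<Rightarrow> 'g) \<Rightarrow> ('g \<Rightarrow> 'g \<Rightarrow> 'g) \<Rightarrow> bool" where
  "bilinear_product scale m \<longleftrightarrow>
     (\<forall>x. Vector_Spaces.linear scale scale (\<lambda>y. m x y)) \<and>
     (\<forall>y. Vector_Spaces.linear scale scale (\<lambda>x. m x y))"

locale pre_lie_algebra = vector_space scale
  for scale :: "'k::field \<Rightarrow> 'g::ab_group_add \<Rightarrow> 'g" +
  fixes m :: "'g \<Rightarrow> 'g \<Rightarrow> 'g"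
  assumes bilinear: "bilinear_product scale m"
    and left_symmetric: "m (m x y) z - m x (m y z) = m (m y x) z - m y (m x z)"

locale compatible_pre_lie_algebra =
  first: pre_lie_algebra scale m1 + second: pre_lie_algebra scale m2
  for scale :: "'k::field \<Rightarrow> 'g::ab_group_add \<Rightarrow> 'g"
    and m1 m2 :: "'g \<Rightarrow> 'g \<Rightarrow> 'g" +
  assumes compatible:
    "m1 (m2 x y) z + m2 (m1 x y) z - m1 x (m2 y z) - m2 x (m1 y z)
     - m1 (m2 y x) z - m2 (m1 y x) z + m1 y (m2 x z) + m2 y (m1 x z) = 0"

section \<open>Bidifferential graded Lie algebras\<close>

text \<open>
  A graded space is an internal direct sum: \<open>G i\<close> is the part of degree \<open>i\<close>, and the
  space itself is \<open>total\<close>, which may be a proper subspace of the ambient vector space.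
  Operations are only constrained on \<open>total\<close>.
\<close>

locale graded_vector_space = vector_space scale
  for scale :: "'k::field \<Rightarrow> 'v::ab_group_add \<Rightarrow> 'v" +
  fixes G :: "nat \<Rightarrow> 'v set"
  assumes subspace_component: "subspace (G i)"
    and direct: "\<lbrakk>finite I; \<And>i. i \<in> I \<Longrightarrow> x i \<in> G i; (\<Sum>i\<in>I. x i) = 0; j \<in> I\<rbrakk> \<Longrightarrow> x j = 0"
begin

definition total :: "'v set" where
  "total = span (\<Union>i. G i)"

end

locale graded_lie_algebra = graded_vector_space scale G
  for scale :: "'k::field \<Rightarrow> 'v::ab_group_add \<Rightarrow> 'v" and G :: "nat \<Rightarrow> 'v set" +
  fixes br :: "'v \<Rightarrow> 'v \<Rightarrow> 'v"
  assumes br_add_left: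
      "\<lbrakk>x \<in> total; y \<in> total; z \<in> total\<rbrakk> \<Longrightarrow> br (x + y) z = br x z + br y z"
    and br_add_right:
      "\<lbrakk>x \<in> total; y \<in> total; z \<in> total\<rbrakk> \<Longrightarrow> br x (y + z) = br x y + br x z"
    and br_scale_left:
      "\<lbrakk>x \<in> total; y \<in> total\<rbrakk> \<Longrightarrow> br (scale c x) y = scale c (br x y)"
    and br_scale_right:
      "\<lbrakk>x \<in> total; y \<in> total\<rbrakk> \<Longrightarrow> br x (scale c y) = scale c (br x y)"
    and br_degree:
      "\<lbrakk>x \<in> G i; y \<in> G j\<rbrakk> \<Longrightarrow> br x y \<in> G (i + j)"
    and br_skew:
      "\<lbrakk>x \<in> G i; y \<in> G j\<rbrakk> \<Longrightarrow> br x y = - scale ((-1) ^ (i * j)) (br y x)"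
    and br_jacobi:
      "\<lbrakk>x \<in> G i; y \<in> G j; z \<in> G k\<rbrakk> \<Longrightarrow>
         br x (br y z) = br (br x y) z + scale ((-1) ^ (i * j)) (br y (br x z))"

locale differential_graded_lie_algebra = graded_lie_algebra scale G br
  for scale :: "'k::field \<Rightarrow> 'v::ab_group_add \<Rightarrow> 'v" and G :: "nat \<Rightarrow> 'v set"
    and br :: "'v \<Rightarrow> 'v \<Rightarrow> 'v" +
  fixes d :: "'v \<Rightarrow> 'v"
  assumes d_add: "\<lbrakk>x \<in> total; y \<in> total\<rbrakk> \<Longrightarrow> d (x + y) = d x + d y"
    and d_scale: "x \<in> total \<Longrightarrow> d (scale c x) = scale c (d x)"
    and d_degree: "x \<in> G i \<Longrightarrow> d x \<in> G (Suc i)"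
    and d_square: "x \<in> total \<Longrightarrow> d (d x) = 0"
    and d_derivation:
      "\<lbrakk>x \<in> G i; y \<in> G j\<rbrakk> \<Longrightarrow> d (br x y) = br (d x) y + scale ((-1) ^ i) (br x (d y))"

locale bidifferential_graded_lie_algebra =
  first: differential_graded_lie_algebra scale G br d1 +
  second: differential_graded_lie_algebra scale G br d2
  for scale :: "'k::field \<Rightarrow> 'v::ab_group_add \<Rightarrow> 'v" and G :: "nat \<Rightarrow> 'v set"
    and br :: "'v \<Rightarrow> 'v \<Rightarrow> 'v" and d1 d2 :: "'v \<Rightarrow> 'v" +
  assumes d_anticommute: "x \<in> first.total \<Longrightarrow> d1 (d2 x) + d2 (d1 x) = 0"

definition maurer_cartan_pair ::
  "('k::field \<Rightarrow> 'v::ab_group_add \<Rightarrow> 'v) \<Rightarrow> (nat \<Rightarrow> 'v set) \<Rightarrow> ('v \<Rightarrow> 'v \<Rightarrow> 'v) \<Rightarrow>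
   ('v \<Rightarrow> 'v) \<Rightarrow> ('v \<Rightarrow> 'v) \<Rightarrow> 'v \<Rightarrow> 'v \<Rightarrow> bool" where
  "maurer_cartan_pair scale G br d1 d2 P1 P2 \<longleftrightarrow>
     P1 \<in> G 1 \<and> P2 \<in> G 1 \<and>
     d1 P1 + scale (1 / 2) (br P1 P1) = 0 \<and>
     d2 P2 + scale (1 / 2) (br P2 P2) = 0 \<and>
     d1 P2 + d2 P1 + br P1 P2 = 0"

section \<open>Cochains and the Matsushima-Nijenhuis bracket\<close>

text \<open>
  \<open>cochains scale n\<close> is Hom of \<open>\<Lambda>\<^sup>n\<^sup>-\<^sup>1 \<gg> \<otimes> \<gg>\<close> into \<open>\<gg>\<close> for \<open>n \<ge> 1\<close>: the maps of \<open>n\<close> arguments,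
  passed as a list, that are multilinear and alternating in the first \<open>n - 1\<close> arguments.
  A cochain is extended by 0 to lists of any other length, so that cochains of all arities live
  in one vector space and form an internal direct sum there.
\<close>

definition cochains ::
  "('k::field \<Rightarrow> 'g::ab_group_add \<Rightarrow> 'g) \<Rightarrow> nat \<Rightarrow> ('g list \<Rightarrow> 'g) set" where
  "cochains scale n = {f.
     (\<forall>xs. length xs \<noteq> n \<longrightarrow> f xs = 0) \<and>
     (\<forall>xs i. length xs = n \<and> i < n \<longrightarrow> Vector_Spaces.linear scale scale (\<lambda>v. f (xs[i := v]))) \<and>
     (\<forall>xs i j. length xs = n \<and> i < j \<and> j < n - 1 \<and> xs ! i = xs ! j \<longrightarrow> f xs = 0)}"

definition cochain_degree ::
  "('k::field \<Rightarrow> 'g::ab_group_add \<Rightarrow> 'g) \<Rightarrow> nat \<Rightarrow> ('g list \<Rightarrow> 'g) set" where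
  "cochain_degree scale p = cochains scale (p + 1)"

definition cochain_scale ::
  "('k::field \<Rightarrow> 'g::ab_group_add \<Rightarrow> 'g) \<Rightarrow> 'k \<Rightarrow> ('g list \<Rightarrow> 'g) \<Rightarrow> ('g list \<Rightarrow> 'g)" where
  "cochain_scale scale c f = (\<lambda>xs. scale c (f xs))"

definition cochain_of_product ::
  "('g::ab_group_add \<Rightarrow> 'g \<Rightarrow> 'g) \<Rightarrow> ('g list \<Rightarrow> 'g)" where
  "cochain_of_product m xs = (if length xs = 2 then m (xs ! 0) (xs ! 1) else 0)"

text \<open>
  Unshuffles permute \<open>{0..<n}\<close> instead of \<open>{1..n}\<close>, matching list indexing; \<open>bs\<close> lists the
  block lengths.
\<close>

definition unshuffles :: "nat list \<Rightarrow> (nat \<Rightarrow> nat) set" where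
  "unshuffles bs = {\<sigma>. \<sigma> permutes {0..<sum_list bs} \<and>
     (\<forall>j < length bs.
        strict_mono_on {sum_list (take j bs)..<sum_list (take (Suc j) bs)} \<sigma>)}"

text \<open>The composition \<open>P \<circ> Q\<close> for \<open>P\<close> of degree \<open>p\<close> and \<open>Q\<close> of degree \<open>q\<close>.\<close>

definition mn_circ ::
  "('k::field \<Rightarrow> 'g::ab_group_add \<Rightarrow> 'g) \<Rightarrow> nat \<Rightarrow> nat \<Rightarrow>
   ('g list \<Rightarrow> 'g) \<Rightarrow> ('g list \<Rightarrow> 'g) \<Rightarrow> ('g list \<Rightarrow> 'g)" where
  "mn_circ scale p q P Q xs =
     (if length xs \<noteq> p + q + 1 then 0 else
       (if p = 0 then 0 else
         (\<Sum>\<sigma>\<in>unshuffles [q, 1, p - 1]. scale (of_int (sign \<sigma>))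
            (P (Q (map (\<lambda>i. xs ! \<sigma> i) [0..<q + 1]) #
                map (\<lambda>i. xs ! \<sigma> i) [q + 1..<p + q] @ [xs ! (p + q)])))) +
       scale ((-1) ^ (p * q))
         (\<Sum>\<sigma>\<in>unshuffles [p, q]. scale (of_int (sign \<sigma>))
            (P (map (\<lambda>i. xs ! \<sigma> i) [0..<p] @
                [Q (map (\<lambda>i. xs ! \<sigma> i) [p..<p + q] @ [xs ! (p + q)])]))))"

definition mn_bracket_hom ::
  "('k::field \<Rightarrow> 'g::ab_group_add \<Rightarrow> 'g) \<Rightarrow> nat \<Rightarrow> nat \<Rightarrow>
   ('g list \<Rightarrow> 'g) \<Rightarrow> ('g list \<Rightarrow> 'g) \<Rightarrow> ('g list \<Rightarrow> 'g)" where
  "mn_bracket_hom scale p q P Q =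
     mn_circ scale p q P Q - cochain_scale scale ((-1) ^ (p * q)) (mn_circ scale q p Q P)"

text \<open>
  The bracket of arbitrary elements of the direct sum. \<open>mn_bracket_hom scale p q P Q\<close> depends
  only on the values of \<open>P\<close> and \<open>Q\<close> on lists of length \<open>p + 1\<close> and \<open>q + 1\<close>, i.e. on their
  components of degrees \<open>p\<close> and \<open>q\<close>, and it vanishes at \<open>xs\<close> unless \<open>p + q + 1 = length xs\<close>.
  Hence this is the bilinear extension of \<open>mn_bracket_hom\<close>; the lemma below confirms that
  it agrees with it on homogeneous elements.
\<close>

definition mn_bracket ::
  "('k::field \<Rightarrow> 'g::ab_group_add \<Rightarrow> 'g) \<Rightarrow>
   ('g list \<Rightarrow> 'g) \<Rightarrow> ('g list \<Rightarrow> 'g) \<Rightarrow> ('g list \<Rightarrow> 'g)" where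
  "mn_bracket scale P Q xs =
     (\<Sum>(p, q) \<in> {(p, q). p + q + 1 = length xs}. mn_bracket_hom scale p q P Q xs)"

lemma cochain_zero_slot:
  assumes "f \<in> cochains scale n" and "0 \<in> set ys"
  shows "f ys = 0"
proof (cases "length ys = n")
  case True
  from assms(2) obtain i where i: "i < length ys" "ys ! i = 0"
    by (auto simp: in_set_conv_nth)
  have lin: "Vector_Spaces.linear scale scale (\<lambda>v. f (ys[i := v]))"
    using assms(1) True i(1) by (auto simp: cochains_def)
  have "f (ys[i := 0]) = 0"
    using module_hom.zero[OF Vector_Spaces.linear.axioms(3)[OF lin]] by simp
  moreover have "ys[i := 0] = ys" using i by (metis list_update_id)
  ultimately show ?thesis by simp
qed (use assms(1) in \<open>auto simp: cochains_def\<close>)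

lemma mn_circ_other_degree:
  assumes vs: "vector_space scale"
    and P: "P \<in> cochain_degree scale p" and Q: "Q \<in> cochain_degree scale q"
    and ne: "p' \<noteq> p \<or> q' \<noteq> q"
  shows "mn_circ scale p' q' P Q xs = 0"
proof -
  interpret vector_space scale by (rule vs)
  have P0: "P ys = 0" if "length ys \<noteq> p + 1 \<or> 0 \<in> set ys" for ys
    using P cochain_zero_slot[of P scale "p + 1" ys] that
    by (auto simp: cochain_degree_def cochains_def)
  have Q0: "Q ys = 0" if "length ys \<noteq> q + 1" for ys
    using Q that by (auto simp: cochain_degree_def cochains_def)
  have a: "P (Q (map (\<lambda>i. xs ! \<sigma> i) [0..<q' + 1]) #
             map (\<lambda>i. xs ! \<sigma> i) [q' + 1..<p' + q'] @ [xs ! (p' + q')]) = 0"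
    if "p' \<noteq> 0" for \<sigma>
    by (rule P0) (use ne that Q0[of "map (\<lambda>i. xs ! \<sigma> i) [0..<q' + 1]"] in auto)
  have b: "P (map (\<lambda>i. xs ! \<sigma> i) [0..<p'] @
             [Q (map (\<lambda>i. xs ! \<sigma> i) [p'..<p' + q'] @ [xs ! (p' + q')])]) = 0" for \<sigma>
    by (rule P0)
      (use ne Q0[of "map (\<lambda>i. xs ! \<sigma> i) [p'..<p' + q'] @ [xs ! (p' + q')]"] in auto)
  show ?thesis by (auto simp only: mn_circ_def a b scale_zero_right sum.neutral_const
        if_cancel if_False add_0 if_True split: if_split)
qed

lemma mn_bracket_homogeneous:
  assumes vs: "vector_space scale"
    and P: "P \<in> cochain_degree scale p" and Q: "Q \<in> cochain_degree scale q"
  shows "mn_bracket scale P Q = mn_bracket_hom scale p q P Q"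
proof
  fix xs :: "'b list"
  interpret vector_space scale by (rule vs)
  let ?S = "{(p, q). p + q + 1 = length xs}"
  have fin: "finite ?S"
    by (rule finite_subset[of _ "{..length xs} \<times> {..length xs}"]) auto
  have other: "mn_bracket_hom scale a b P Q xs = 0" if "a \<noteq> p \<or> b \<noteq> q" for a b
    using mn_circ_other_degree[OF vs P Q that, of xs] mn_circ_other_degree[OF vs Q P, of b a xs] that
    by (auto simp: mn_bracket_hom_def cochain_scale_def)
  have out: "mn_bracket_hom scale p q P Q xs = 0" if "(p, q) \<notin> ?S"
    using that by (auto simp: mn_bracket_hom_def mn_circ_def cochain_scale_def)
  have "mn_bracket scale P Q xs =
      (\<Sum>z\<in>?S. if z = (p, q) then mn_bracket_hom scale p q P Q xs else 0)"
    unfolding mn_bracket_def by (rule sum.cong) (auto, (use other in blast)+)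
  also have "\<dots> = mn_bracket_hom scale p q P Q xs"
    using fin out by (auto simp: sum.delta)
  finally show "mn_bracket scale P Q xs = mn_bracket_hom scale p q P Q xs" .
qed

end

theory Submission
  imports Defs
begin

text \<open>
  Let \<open>circ\<close> be the Nijenhuis product \<open>P \<circ> Q\<close>. Its associator \<open>(P \<circ> Q) \<circ> R - P \<circ> (Q \<circ> R)\<close> only
  retains the terms in which \<open>Q\<close> and \<open>R\<close> are inserted into different arguments of \<open>P\<close>, so it is
  graded symmetric in \<open>Q\<close> and \<open>R\<close>, and the graded commutator of such a product satisfies the
  graded Jacobi identity. The sums over unshuffles are evaluated as a signed coproduct on lists,
  defined by recursion; what is needed of unshuffles is then that this coproduct is coassociative and
  graded cocommutative. In particular nothing is divided by factorials, and the characteristic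
  only enters in passing between skew symmetric and alternating maps and in halving
  \<open>[\<pi>, \<pi>]\<close>.

  A compatible pair of pre-Lie products is a pair of elements of degree one with
  \<open>[\<pi>\<^sub>1, \<pi>\<^sub>1] = [\<pi>\<^sub>2, \<pi>\<^sub>2] = [\<pi>\<^sub>1, \<pi>\<^sub>2] = 0\<close>. The Jacobi identity makes the two adjoint maps
  anticommuting differentials, and expanding these brackets at \<open>\<pi>\<^sub>i + \<pi>\<^sub>i'\<close> gives the Maurer-Cartan
  equations.
\<close>

section \<open>The unshuffle coproduct on lists\<close>

text \<open>Multiplication by (-1)^n, written without scalars so that the coproduct identities hold
  in any abelian group.\<close>

definition signed :: "nat \<Rightarrow> 'v::ab_group_add \<Rightarrow> 'v" where
  "signed n v = (if even n then v else - v)"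

lemma signed_zero [simp]: "signed n 0 = 0"
  and signed_0 [simp]: "signed 0 v = v"
  and signed_add: "signed n (u + v) = signed n u + signed n v"
  and signed_minus: "signed n (- v) = - signed n v"
  and signed_Suc [simp]: "signed (Suc n) v = - signed n v"
  and signed_signed [simp]: "signed m (signed n v) = signed (m + n) v"
  by (auto simp: signed_def)

lemma signed_parity: "even m = even n \<Longrightarrow> signed m v = signed n v"
  by (simp add: signed_def)

lemma (in additive) signed: "f (signed n v) = signed n (f v)"
  by (simp add: signed_def minus)

text \<open>Sum over all ways to split the list into complementary subsequences \<open>b\<close> and
  \<open>c\<close>, weighted by the sign of the corresponding unshuffle: the head either stays in
  front in \<open>b\<close>, or passes the whole of \<open>b\<close> to enter \<open>c\<close>. All
  block lengths occur; particular ones are selected by letting \<open>G\<close> vanish elsewhere.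
  The recursion changes \<open>G\<close>, hence the generalisation over \<open>G\<close> in the
  inductions.\<close>

fun unshuffle_sum :: "('a list \<Rightarrow> 'a list \<Rightarrow> 'v::ab_group_add) \<Rightarrow> 'a list \<Rightarrow> 'v" where
  "unshuffle_sum G [] = G [] []"
| "unshuffle_sum G (x # xs) =
     unshuffle_sum (\<lambda>b c. G (x # b) c + signed (length b) (G b (x # c))) xs"

lemma unshuffle_sum_cong:
  assumes "\<And>b c. length b + length c = length xs \<Longrightarrow> G b c = H b c"
  shows "unshuffle_sum G xs = unshuffle_sum H xs"
  using assms
proof (induction xs arbitrary: G H)
  case (Cons x xs)
  show ?case unfolding unshuffle_sum.simps
    by (rule Cons.IH) (simp add: Cons.prems)
qed simp

lemma unshuffle_sum_add:
  "unshuffle_sum (\<lambda>b c. G b c + H b c) xs = unshuffle_sum G xs + unshuffle_sum H xs"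
proof (induction xs arbitrary: G H)
  case (Cons x xs)
  show ?case unfolding unshuffle_sum.simps Cons.IH[symmetric]
    by (rule unshuffle_sum_cong) (simp add: signed_add algebra_simps)
qed simp

lemma unshuffle_sum_zero [simp]: "unshuffle_sum (\<lambda>b c. 0) xs = 0"
  by (induction xs) auto

lemma unshuffle_sum_additive:
  assumes "additive f"
  shows "f (unshuffle_sum G xs) = unshuffle_sum (\<lambda>b c. f (G b c)) xs"
proof -
  interpret additive f by (rule assms)
  show ?thesis by (induction xs arbitrary: G) (simp_all add: add signed)
qed

lemma unshuffle_sum_minus:
  "unshuffle_sum (\<lambda>b c. - G b c) xs = - unshuffle_sum G xs"
  by (subst unshuffle_sum_additive[where f = uminus]) (simp_all add: additive_def)

lemma unshuffle_sum_signed: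
  "unshuffle_sum (\<lambda>b c. signed n (G b c)) xs = signed n (unshuffle_sum G xs)"
  by (subst unshuffle_sum_additive[where f = "signed n"]) (simp_all add: additive_def signed_add)

text \<open>The head enters one of three blocks and picks up one sign for each entry it passes. The
  outer sign \<open>length b\<close> becomes \<open>length b1 + length b2\<close> because the inner
  sum divides \<open>b\<close>.\<close>

lemma unshuffle_sum_unshuffle_sum_Cons:
  "unshuffle_sum (\<lambda>b c. unshuffle_sum (\<lambda>b1 b2. H b1 b2 c) b) (x # xs) =
   unshuffle_sum (\<lambda>b c. unshuffle_sum (\<lambda>b1 b2. H (x # b1) b2 c
     + signed (length b1) (H b1 (x # b2) c)
     + signed (length b1 + length b2) (H b1 b2 (x # c))) b) xs"
  by (simp add: unshuffle_sum_signed[symmetric] unshuffle_sum_add[symmetric])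
    (intro unshuffle_sum_cong, simp)

text \<open>Coassociativity: with either bracketing the head reaches the three blocks with the same
  signs, which gives the same modified summand \<open>?H\<close>, and the induction hypothesis
  applies to it.\<close>

lemma unshuffle_sum_assoc:
  "unshuffle_sum (\<lambda>b c. unshuffle_sum (\<lambda>b1 b2. H b1 b2 c) b) xs =
   unshuffle_sum (\<lambda>b c. unshuffle_sum (\<lambda>c1 c2. H b c1 c2) c) xs"
proof (induction xs arbitrary: H)
  case (Cons x xs)
  let ?H = "\<lambda>b1 b2 b3. H (x # b1) b2 b3 + signed (length b1) (H b1 (x # b2) b3)
              + signed (length b1 + length b2) (H b1 b2 (x # b3))"
  have "unshuffle_sum (\<lambda>b c. unshuffle_sum (\<lambda>c1 c2. ?H b c1 c2) c) xs =
        unshuffle_sum (\<lambda>b c. unshuffle_sum (\<lambda>c1 c2. H b c1 c2) c) (x # xs)"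
    by (simp add: unshuffle_sum_signed[symmetric] unshuffle_sum_add[symmetric])
      (intro unshuffle_sum_cong, simp add: signed_add algebra_simps)
  then show ?case
    by (subst unshuffle_sum_unshuffle_sum_Cons, subst Cons.IH) simp
qed simp

text \<open>Graded cocommutativity with every entry odd: interchanging the blocks moves each entry
  of one past each entry of the other.\<close>

lemma unshuffle_sum_commute:
  "unshuffle_sum G xs = unshuffle_sum (\<lambda>b c. signed (length b * length c) (G c b)) xs"
proof (induction xs arbitrary: G)
  case (Cons x xs)
  show ?case unfolding unshuffle_sum.simps
    by (subst Cons.IH, rule unshuffle_sum_cong)
      (auto simp: signed_add algebra_simps signed_def)
qed simp

section \<open>The Nijenhuis product and its associator\<close>

text \<open>
  From here on a cochain is a function of the list of its skew arguments and of its last argument,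
  and a composition has the skew arguments of the inner cochain as first block. With this order
  the formula for \<open>P \<circ> Q\<close> carries no sign and no reference to degrees.
\<close>

definition skew :: "('a list \<Rightarrow> 'a \<Rightarrow> 'v::ab_group_add) \<Rightarrow> 'a list \<Rightarrow> 'v" where
  "skew Q = unshuffle_sum (\<lambda>b c. if length c = 1 then Q b (hd c) else 0)"

definition circ ::
  "('a::ab_group_add list \<Rightarrow> 'a \<Rightarrow> 'a) \<Rightarrow> ('a list \<Rightarrow> 'a \<Rightarrow> 'a) \<Rightarrow> 'a list \<Rightarrow> 'a \<Rightarrow> 'a" where
  "circ P Q ys y = unshuffle_sum (\<lambda>b c. P (skew Q b # c) y + P c (Q b y)) ys"

text \<open>The counit law: only the splitting with all entries in the first block survives, and its
  sign is plus.\<close>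

lemma unshuffle_sum_Nil_right: "unshuffle_sum (\<lambda>b c. if c = [] then f b else 0) xs = f xs"
  by (induction xs arbitrary: f) simp_all

text \<open>Either \<open>x\<close> stays among the skew arguments, or it is the singled-out last
  argument and has passed all of \<open>xs\<close>. The counit law collects the second case into one
  term.\<close>

lemma skew_Cons:
  "skew Q (x # xs) = unshuffle_sum (\<lambda>b c. if length c = 1 then Q (x # b) (hd c) else 0) xs
     + signed (length xs) (Q xs x)"
  unfolding skew_def unshuffle_sum.simps
    unshuffle_sum_Nil_right[of "\<lambda>b. signed (length b) (Q b x)" xs, symmetric]
    unshuffle_sum_add[symmetric]
  by (rule unshuffle_sum_cong) auto

text \<open>The terms with \<open>R\<close> in a skew argument of \<open>Q\<close> and those with
  \<open>R\<close> in its last argument are the two cases of \<open>skew_Cons\<close> for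
  \<open>skew R r # q\<close>.\<close>

lemma skew_circ:
  assumes last: "\<And>c. additive (Q c)"
  shows "skew (circ Q R) xs = unshuffle_sum (\<lambda>r q. skew Q (skew R r # q)) xs"
proof -
  have "skew (circ Q R) xs = unshuffle_sum (\<lambda>b m. unshuffle_sum (\<lambda>r c.
      if length m = 1 then Q (skew R r # c) (hd m) + Q c (R r (hd m)) else 0) b) xs"
    unfolding skew_def[of "circ Q R"] circ_def by (rule unshuffle_sum_cong) auto
  also have "\<dots> = unshuffle_sum (\<lambda>r d. unshuffle_sum (\<lambda>c m.
      if length m = 1 then Q (skew R r # c) (hd m) + Q c (R r (hd m)) else 0) d) xs"
    by (rule unshuffle_sum_assoc)
  also have "\<dots> = unshuffle_sum (\<lambda>r d. unshuffle_sum (\<lambda>c m.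
      if length m = 1 then Q (skew R r # c) (hd m) else 0) d) xs
     + unshuffle_sum (\<lambda>r d. unshuffle_sum (\<lambda>c m.
      if length m = 1 then Q c (R r (hd m)) else 0) d) xs"
    unfolding unshuffle_sum_add[symmetric] by (intro unshuffle_sum_cong) auto
  \<comment> \<open>Exchanging \<open>c\<close> and \<open>m\<close> puts \<open>m\<close> next to
    \<open>r\<close>, so that coassociativity can join them into one block, whose sum is
    \<open>skew R\<close>. As \<open>m\<close> has length one, the sign is that of
    \<open>length c\<close>.\<close>
  also have "unshuffle_sum (\<lambda>r d. unshuffle_sum (\<lambda>c m.
      if length m = 1 then Q c (R r (hd m)) else 0) d) xs =
    unshuffle_sum (\<lambda>r d. unshuffle_sum (\<lambda>m c.
      if length m = 1 then signed (length c) (Q c (R r (hd m))) else 0) d) xs"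
    by (rule unshuffle_sum_cong, subst unshuffle_sum_commute, rule unshuffle_sum_cong) auto
  also have "\<dots> = unshuffle_sum (\<lambda>b c. unshuffle_sum (\<lambda>r m.
      if length m = 1 then signed (length c) (Q c (R r (hd m))) else 0) b) xs"
    by (rule unshuffle_sum_assoc[symmetric])
  also have "\<dots> = unshuffle_sum (\<lambda>r q. signed (length q) (Q q (skew R r))) xs"
    unfolding skew_def
    by (subst unshuffle_sum_additive[OF last], rule unshuffle_sum_cong,
       subst unshuffle_sum_signed[symmetric], rule unshuffle_sum_cong)
     (auto simp: additive.zero[OF last])
  finally show ?thesis
    by (simp add: unshuffle_sum_add skew_Cons)
qed

lemma skew_eq_0:
  assumes "\<And>b y. length b \<noteq> q \<Longrightarrow> Q b y = 0" "length b \<noteq> Suc q"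
  shows "skew Q b = 0"
proof -
  have "skew Q b = unshuffle_sum (\<lambda>_ _. 0) b"
    unfolding skew_def by (rule unshuffle_sum_cong) (use assms in auto)
  then show ?thesis by simp
qed

text \<open>The terms of the associator: \<open>Q\<close> and \<open>R\<close> are inserted into different arguments of \<open>P\<close>.\<close>

definition associator where
  "associator P Q R ys y = unshuffle_sum (\<lambda>r d. unshuffle_sum (\<lambda>b c.
      signed (length b) (P (skew Q b # skew R r # c) y)
       + signed (length b) (P (skew R r # c) (Q b y))
       + P (skew Q b # c) (R r y)) d) ys"

text \<open>The entries split into blocks for \<open>R\<close>, for \<open>Q\<close> and for the
  rest of \<open>P\<close>. The terms \<open>?A\<close>, with \<open>R\<close> inside
  \<open>Q\<close>, reassemble to P \<circ> (Q \<circ> R) by coassociativity and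
  \<open>skew_circ\<close>; in all others \<open>Q\<close> and \<open>R\<close> occupy different
  arguments of \<open>P\<close>.\<close>

lemma circ_circ:
  fixes P Q R :: "'a::ab_group_add list \<Rightarrow> 'a \<Rightarrow> 'a"
  assumes P: "\<And>c y. additive (\<lambda>v. P (v # c) y)" "\<And>c. additive (P c)"
    and Q: "\<And>c. additive (Q c)"
  shows "circ (circ P Q) R ys y = circ P (circ Q R) ys y + associator P Q R ys y"
proof -
  let ?A = "\<lambda>r b c. P (skew Q (skew R r # b) # c) y + P c (Q (skew R r # b) y) + P c (Q b (R r y))"
  have "circ (circ P Q) R ys y =
     unshuffle_sum (\<lambda>r d. unshuffle_sum (\<lambda>b c. ?A r b c) d) ys + associator P Q R ys y"
    unfolding circ_def associator_def unshuffle_sum.simps unshuffle_sum_add[symmetric]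
    by (intro unshuffle_sum_cong) (simp add: signed_add algebra_simps)
  also have "unshuffle_sum (\<lambda>r d. unshuffle_sum (\<lambda>b c. ?A r b c) d) ys =
       unshuffle_sum (\<lambda>e c. unshuffle_sum (\<lambda>r b. ?A r b c) e) ys"
    by (rule unshuffle_sum_assoc[symmetric])
  also have "\<dots> = circ P (circ Q R) ys y"
    unfolding circ_def[of P] skew_circ[where Q = Q, OF Q] circ_def
     unshuffle_sum_additive[OF P(1)] unshuffle_sum_additive[OF P(2)] unshuffle_sum_add[symmetric]
     additive.add[OF P(2)]
    by (intro unshuffle_sum_cong) (simp add: algebra_simps)
  finally show ?thesis .
qed

text \<open>Cocommutativity exchanges the blocks of \<open>Q\<close> and \<open>R\<close>. The term
  with both in skew arguments is carried to itself by skew symmetry of \<open>P\<close>, and the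
  other two terms are carried to each other. The arities fix the block lengths and thereby the
  sign.\<close>

lemma associator_commute:
  fixes P Q R :: "'a::ab_group_add list \<Rightarrow> 'a \<Rightarrow> 'a"
  assumes P: "\<And>c y. additive (\<lambda>v. P (v # c) y)" "\<And>c. additive (P c)"
    and skew: "\<And>u v c y. P (u # v # c) y = - P (v # u # c) y"
    and Q: "\<And>b y. length b \<noteq> q \<Longrightarrow> Q b y = 0"
    and R: "\<And>b y. length b \<noteq> r \<Longrightarrow> R b y = 0"
  shows "associator P R Q ys y = signed (q * r) (associator P Q R ys y)"
proof -
  let ?H = "\<lambda>Q R r b c. signed (length b) (P (skew Q b # skew R r # c) y)
       + signed (length b) (P (skew R r # c) (Q b y))
       + P (skew Q b # c) (R r y)"
  have P0: "P (0 # c) y = 0" "P (u # 0 # c) y = 0" "P c 0 = 0" for u c y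
    using additive.zero[OF P(1)] additive.zero[OF P(2)] skew[of u 0] by simp_all
  \<comment> \<open>Nonzero terms have blocks of lengths q + 1 and r + 1. The parities of (r + 1)(q
    + 1) + (r + 1) and qr + (q + 1) differ by one, which the exchange of two arguments of
    \<open>P\<close> makes up for.\<close>
  have 1: "signed (length a * length b) (signed (length a) (P (skew R a # skew Q b # c) y))
    = signed (q * r) (signed (length b) (P (skew Q b # skew R a # c) y))" for a b c
  proof (cases "length b = Suc q \<and> length a = Suc r")
    case True
    then show ?thesis by (subst skew) (auto simp: signed_def)
  qed (use skew_eq_0[where Q = Q, OF Q] skew_eq_0[where Q = R, OF R] P0 in auto)
  have 2: "signed (length a * length b) (signed (length a) (P (skew Q b # c) (R a y)))
    = signed (q * r) (P (skew Q b # c) (R a y))" for a b c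
  proof (cases "length b = Suc q \<and> length a = r")
    case True
    then show ?thesis by (auto simp: signed_def)
  qed (use skew_eq_0[where Q = Q, OF Q] R P0 in auto)
  have 3: "signed (length a * length b) (P (skew R a # c) (Q b y))
    = signed (q * r) (signed (length b) (P (skew R a # c) (Q b y)))" for a b c
  proof (cases "length b = q \<and> length a = Suc r")
    case True
    then show ?thesis by (auto simp: signed_def)
  qed (use skew_eq_0[where Q = R, OF R] Q P0 in auto)
  have "associator P R Q ys y = unshuffle_sum (\<lambda>e c. unshuffle_sum (\<lambda>a b. ?H R Q a b c) e) ys"
    unfolding associator_def by (rule unshuffle_sum_assoc[symmetric])
  also have "\<dots> = unshuffle_sum (\<lambda>e c. unshuffle_sum (\<lambda>a b. signed (q * r) (?H Q R a b c)) e) ys"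
    by (rule unshuffle_sum_cong, subst unshuffle_sum_commute, rule unshuffle_sum_cong)
      (simp only: signed_add 1 2 3 add_ac)
  also have "\<dots> = signed (q * r) (associator P Q R ys y)"
    unfolding associator_def unshuffle_sum_signed unshuffle_sum_assoc ..
  finally show ?thesis .
qed

section \<open>Sums over unshuffles\<close>

text \<open>
  An unshuffle takes the value 0 at the start of one of its nonempty blocks. Deleting that value
  leaves an unshuffle with this block shortened by one, and \<open>insert_perm\<close> is the inverse of the
  deletion. This matches the recursion that defines \<open>unshuffle_sum\<close>.
\<close>

definition insert_perm :: "nat \<Rightarrow> (nat \<Rightarrow> nat) \<Rightarrow> nat \<Rightarrow> nat" where
  "insert_perm s \<sigma> i = (if i < s then Suc (\<sigma> i) else if i = s then 0 else Suc (\<sigma> (i - 1)))"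

text \<open>This is the cycle that brings the value 0 to position \<open>s\<close>; each increment
  of \<open>s\<close> composes with one further adjacent transposition.\<close>

lemma insert_perm_cycle:
  assumes "s \<le> n"
  shows "insert_perm s id permutes {0..<Suc n} \<and> sign (insert_perm s id) = (-1) ^ s"
  using assms
proof (induction s)
  case 0
  have "insert_perm 0 id = id" by (auto simp: insert_perm_def fun_eq_iff)
  then show ?case by (simp only: permutes_id sign_id power_0 simp_thms)
next
  case (Suc s)
  have eq: "insert_perm (Suc s) id = insert_perm s id \<circ> transpose s (Suc s)"
    by (auto simp: insert_perm_def fun_eq_iff transpose_def)
  have t: "transpose s (Suc s) permutes {0..<Suc n}"
    using Suc.prems by (intro permutes_swap_id) auto
  have IH: "insert_perm s id permutes {0..<Suc n}" "sign (insert_perm s id) = (-1) ^ s"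
    using Suc.IH[OF Suc_leD[OF Suc.prems]] by blast+
  note perm = permutes_imp_permutation[OF finite_atLeastLessThan]
  show ?case
    unfolding eq sign_compose[OF perm[OF IH(1)] perm[OF t]] sign_swap_id IH(2)
    by (intro conjI permutes_compose[OF t IH(1)]) simp
qed

text \<open>Shifting by one turns the transposition of \<open>a\<close> and \<open>b\<close> into
  that of \<open>Suc a\<close> and \<open>Suc b\<close>, so an induction over transpositions keeps
  track of the sign.\<close>

lemma insert_perm_lift:
  assumes "\<sigma> permutes {0..<n}"
  shows "insert_perm 0 \<sigma> permutes {0..<Suc n} \<and> sign (insert_perm 0 \<sigma>) = sign \<sigma>"
  using finite_atLeastLessThan assms
proof (induction rule: permutes_rev_induct)
  case id
  have "insert_perm 0 id = id" by (auto simp: insert_perm_def fun_eq_iff)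
  then show ?case by (simp only: permutes_id simp_thms)
next
  case (swap a b p)
  have eq: "insert_perm 0 (p \<circ> transpose a b) = insert_perm 0 p \<circ> transpose (Suc a) (Suc b)"
    by (auto simp: insert_perm_def fun_eq_iff transpose_def)
  have t: "transpose (Suc a) (Suc b) permutes {0..<Suc n}"
    using swap by (intro permutes_swap_id) auto
  have IH: "insert_perm 0 p permutes {0..<Suc n}" "sign (insert_perm 0 p) = sign p"
    using swap by simp_all
  have t': "transpose a b permutes {0..<n}"
    using swap by (intro permutes_swap_id)
  note perm = permutes_imp_permutation[OF finite_atLeastLessThan]
  show ?case
    unfolding eq sign_compose[OF perm[OF IH(1)] perm[OF t]] sign_swap_id IH(2)
      sign_compose[OF perm[OF \<open>p permutes {0..<n}\<close>] perm[OF t']]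
    by (intro conjI permutes_compose[OF t IH(1)]) simp
qed

text \<open>Insertion factors as the lift of \<sigma> after the cycle, and the signs
  multiply.\<close>

lemma insert_perm_permutes_sign:
  assumes "\<sigma> permutes {0..<n}" "s \<le> n"
  shows "insert_perm s \<sigma> permutes {0..<Suc n}" "sign (insert_perm s \<sigma>) = (-1) ^ s * sign \<sigma>"
proof -
  have eq: "insert_perm s \<sigma> = insert_perm 0 \<sigma> \<circ> insert_perm s id"
    by (auto simp: insert_perm_def fun_eq_iff)
  note 1 = insert_perm_lift[OF assms(1)] and 2 = insert_perm_cycle[OF assms(2)]
  have "permutation (insert_perm 0 \<sigma>)" "permutation (insert_perm s id)"
    using 1 2 by (auto intro: permutes_imp_permutation[OF finite_atLeastLessThan])
  then show "insert_perm s \<sigma> permutes {0..<Suc n}" "sign (insert_perm s \<sigma>) = (-1) ^ s * sign \<sigma>"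
    using 1 2 unfolding eq by (auto intro: permutes_compose simp: sign_compose)
qed

lemma insert_perm_surj:
  assumes \<sigma>: "\<sigma> permutes {0..<Suc n}" and s: "\<sigma> s = 0" "s \<le> n"
  obtains \<sigma>' where "\<sigma>' permutes {0..<n}" "\<sigma> = insert_perm s \<sigma>'"
proof -
  \<comment> \<open>Position \<open>s\<close> is skipped and every value lowered by one. By
    injectivity the other values are positive, so the truncated subtraction is exact.\<close>
  define \<sigma>' where "\<sigma>' i = \<sigma> (if i < s then i else Suc i) - 1" for i
  have inj: "\<sigma> i = \<sigma> j \<longleftrightarrow> i = j" for i j
    using permutes_inj[OF \<sigma>] by (auto simp: inj_def)
  have pos: "\<sigma> i \<noteq> 0" if "i \<noteq> s" for i
    using inj[of i s] s that by simp
  have Suc_pred: "Suc (\<sigma> i - Suc 0) = \<sigma> i" if "i \<noteq> s" for i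
    using pos[OF that] by simp
  have ge: "\<sigma> i = i" if "i > n" for i
    using permutes_not_in[OF \<sigma>] that by auto
  have lt: "\<sigma> i < Suc n" if "i \<le> n" for i
    using permutes_in_image[OF \<sigma>, of i] that by auto
  have "\<sigma>' permutes {0..<n}"
  proof (rule inj_imp_permutes)
    show "inj_on \<sigma>' {0..<n}"
    proof (rule inj_onI)
      fix i j assume "\<sigma>' i = \<sigma>' j"
      then have "\<sigma> (if i < s then i else Suc i) = \<sigma> (if j < s then j else Suc j)"
        unfolding \<sigma>'_def using pos[of "if i < s then i else Suc i"] pos[of "if j < s then j else Suc j"]
        by (auto split: if_splits)
      then show "i = j" using inj by (auto split: if_splits)
    qed
  next
    fix i assume "i \<in> {0..<n}"
    then show "\<sigma>' i \<in> {0..<n}"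
      unfolding \<sigma>'_def using lt[of "if i < s then i else Suc i"] pos[of "if i < s then i else Suc i"]
      by (auto split: if_splits)
  next
    fix i assume "i \<notin> {0..<n}"
    then show "\<sigma>' i = i" using s ge[of "Suc i"] by (auto simp: \<sigma>'_def)
  qed simp
  moreover have "\<sigma> = insert_perm s \<sigma>'"
    by (auto simp: fun_eq_iff insert_perm_def \<sigma>'_def Suc_pred s)
  ultimately show ?thesis ..
qed

text \<open>The cases are a block before the inserted position, a block starting at it and a block
  after it. In the second the new value 0 lies below all others and adds no condition.\<close>

lemma strict_mono_on_insert_perm:
  shows "v \<le> s \<Longrightarrow> strict_mono_on {u..<v} (insert_perm s \<sigma>) \<longleftrightarrow> strict_mono_on {u..<v} \<sigma>"
    and "strict_mono_on {s..<Suc v} (insert_perm s \<sigma>) \<longleftrightarrow> strict_mono_on {s..<v} \<sigma>"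
    and "s \<le> u \<Longrightarrow> strict_mono_on {Suc u..<Suc v} (insert_perm s \<sigma>) \<longleftrightarrow> strict_mono_on {u..<v} \<sigma>"
proof -
  show "strict_mono_on {u..<v} (insert_perm s \<sigma>) \<longleftrightarrow> strict_mono_on {u..<v} \<sigma>" if "v \<le> s"
    using that by (auto simp: strict_mono_on_def insert_perm_def)
  have *: "insert_perm s \<sigma> (Suc i) = Suc (\<sigma> i)" if "s \<le> i" for i
    using that by (simp add: insert_perm_def)
  show "strict_mono_on {Suc u..<Suc v} (insert_perm s \<sigma>) \<longleftrightarrow> strict_mono_on {u..<v} \<sigma>" (is "?l = ?r")
    if "s \<le> u" for u
  proof
    assume ?l
    then have "insert_perm s \<sigma> (Suc i) < insert_perm s \<sigma> (Suc j)" if "u \<le> i" "i < j" "j < v" for i j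
      using that by (auto simp: strict_mono_on_def)
    then show ?r using * that by (auto simp: strict_mono_on_def)
  next
    assume ?r
    show ?l
    proof (rule strict_mono_onI)
      fix i j assume "i \<in> {Suc u..<Suc v}" "j \<in> {Suc u..<Suc v}" "i < j"
      then show "insert_perm s \<sigma> i < insert_perm s \<sigma> j" using \<open>?r\<close> that *
        by (cases i; cases j) (auto simp: strict_mono_on_def)
    qed
  qed
  from this[of s] show "strict_mono_on {s..<Suc v} (insert_perm s \<sigma>) \<longleftrightarrow> strict_mono_on {s..<v} \<sigma>"
    by (auto simp: strict_mono_on_def insert_perm_def)
qed

lemma unshuffles3:
  "unshuffles [a, b, c] = {\<sigma>. \<sigma> permutes {0..<a + b + c} \<and> strict_mono_on {0..<a} \<sigma> \<and>
     strict_mono_on {a..<a + b} \<sigma> \<and> strict_mono_on {a + b..<a + b + c} \<sigma>}"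
  by (auto simp: unshuffles_def All_less_Suc numeral_eq_Suc add.assoc less_Suc_eq)

text \<open>An empty third block lets the three-block recursion serve both sums of the
  composition.\<close>

lemma unshuffles2: "unshuffles [a, b] = unshuffles [a, b, 0]"
  unfolding unshuffles3
  by (auto simp: unshuffles_def All_less_Suc numeral_eq_Suc add.assoc less_Suc_eq)

text \<open>Putting 0 in front of a block lengthens it and shifts the later blocks, while increase
  on each block is preserved and reflected; every permutation with value 0 there arises by
  insertion.\<close>

lemma unshuffles3_insert_perm:
  shows "bij_betw (insert_perm 0) (unshuffles [a, b, c]) {\<sigma> \<in> unshuffles [Suc a, b, c]. \<sigma> 0 = 0}"
    and "bij_betw (insert_perm a) (unshuffles [a, b, c]) {\<sigma> \<in> unshuffles [a, Suc b, c]. \<sigma> a = 0}"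
    and "bij_betw (insert_perm (a + b)) (unshuffles [a, b, c]) {\<sigma> \<in> unshuffles [a, b, Suc c]. \<sigma> (a + b) = 0}"
proof -
  have *: "bij_betw (insert_perm s) (unshuffles [a, b, c]) {\<sigma> \<in> unshuffles bs. \<sigma> s = 0}"
    if s: "s \<le> a + b + c" and sum: "sum_list bs = Suc (a + b + c)"
      and iff: "\<And>\<sigma>. \<sigma> permutes {0..<a + b + c} \<Longrightarrow>
         insert_perm s \<sigma> \<in> unshuffles bs \<longleftrightarrow> \<sigma> \<in> unshuffles [a, b, c]" for s bs
    unfolding bij_betw_def
  proof (intro conjI set_eqI iffI)
    show "inj_on (insert_perm s) (unshuffles [a, b, c])"
    proof (rule inj_onI, rule ext)
      fix \<sigma> \<tau> i assume "insert_perm s \<sigma> = insert_perm s \<tau>"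
      then have "insert_perm s \<sigma> (if i < s then i else Suc i) = insert_perm s \<tau> (if i < s then i else Suc i)"
        by simp
      then show "\<sigma> i = \<tau> i" by (auto simp: insert_perm_def split: if_splits)
    qed
  next
    fix \<sigma> assume "\<sigma> \<in> insert_perm s ` unshuffles [a, b, c]"
    then show "\<sigma> \<in> {\<sigma> \<in> unshuffles bs. \<sigma> s = 0}"
      using iff by (auto simp: insert_perm_def unshuffles3)
  next
    fix \<sigma> assume \<sigma>: "\<sigma> \<in> {\<sigma> \<in> unshuffles bs. \<sigma> s = 0}"
    then have "\<sigma> permutes {0..<Suc (a + b + c)}"
      using sum by (auto simp: unshuffles_def)
    then obtain \<sigma>' where "\<sigma>' permutes {0..<a + b + c}" "\<sigma> = insert_perm s \<sigma>'"
      using insert_perm_surj[of \<sigma> "a + b + c" s] \<sigma> s by auto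
    then show "\<sigma> \<in> insert_perm s ` unshuffles [a, b, c]"
      using iff \<sigma> by auto
  qed
  have p: "insert_perm s \<sigma> permutes {0..<Suc (a + b + c)}"
    if "\<sigma> permutes {0..<a + b + c}" "s \<le> a + b + c" for s \<sigma>
    using insert_perm_permutes_sign that by blast
  show "bij_betw (insert_perm 0) (unshuffles [a, b, c]) {\<sigma> \<in> unshuffles [Suc a, b, c]. \<sigma> 0 = 0}"
    by (rule *) (use p in \<open>auto simp: unshuffles3 strict_mono_on_insert_perm\<close>)
  show "bij_betw (insert_perm a) (unshuffles [a, b, c]) {\<sigma> \<in> unshuffles [a, Suc b, c]. \<sigma> a = 0}"
    by (rule *) (use p in \<open>auto simp: unshuffles3 strict_mono_on_insert_perm\<close>)
  show "bij_betw (insert_perm (a + b)) (unshuffles [a, b, c]) {\<sigma> \<in> unshuffles [a, b, Suc c]. \<sigma> (a + b) = 0}"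
    by (rule *) (use p in \<open>auto simp: unshuffles3 strict_mono_on_insert_perm\<close>)
qed

text \<open>The value 0 is attained in some block, and increase on that block forces it to the first
  position.\<close>

lemma unshuffles3_cover:
  assumes "a + b + c \<noteq> 0"
  shows "unshuffles [a, b, c] =
     {\<sigma> \<in> unshuffles [a, b, c]. a \<noteq> 0 \<and> \<sigma> 0 = 0} \<union>
     {\<sigma> \<in> unshuffles [a, b, c]. b \<noteq> 0 \<and> \<sigma> a = 0} \<union>
     {\<sigma> \<in> unshuffles [a, b, c]. c \<noteq> 0 \<and> \<sigma> (a + b) = 0}"
proof -
  have "a \<noteq> 0 \<and> \<sigma> 0 = 0 \<or> b \<noteq> 0 \<and> \<sigma> a = 0 \<or> c \<noteq> 0 \<and> \<sigma> (a + b) = 0"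
    if \<sigma>: "\<sigma> \<in> unshuffles [a, b, c]" for \<sigma>
  proof -
    from \<sigma> have perm: "\<sigma> permutes {0..<a + b + c}" by (simp add: unshuffles3)
    then have "0 \<in> \<sigma> ` {0..<a + b + c}"
      using assms permutes_image[OF perm] by auto
    then obtain k where k: "k < a + b + c" "\<sigma> k = 0" by auto
    have start: "\<sigma> u = 0" if "strict_mono_on {u..<v} \<sigma>" "u \<le> k" "k < v" for u v
      using that(2,3) k(2) that(1)[unfolded strict_mono_on_def, rule_format, of u k]
      by (cases "u = k") auto
    consider "k < a" | "a \<le> k" "k < a + b" | "a + b \<le> k" by linarith
    then show ?thesis
      by cases (use \<sigma> k start in \<open>auto simp: unshuffles3\<close>)
  qed
  then show ?thesis by blast
qed

lemma finite_unshuffles: "finite (unshuffles bs)"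
  by (rule finite_subset[OF _ finite_permutations[of "{0..<sum_list bs}"]])
    (auto simp: unshuffles_def)

text \<open>The unshuffles are classified by the block that contains the value 0, and each class is
  reindexed by insertion.\<close>

lemma sum_unshuffles3:
  assumes "a + b + c \<noteq> 0"
  shows "(\<Sum>\<sigma>\<in>unshuffles [a, b, c]. f \<sigma>) =
     (case a of 0 \<Rightarrow> 0 | Suc a' \<Rightarrow> \<Sum>\<sigma>\<in>unshuffles [a', b, c]. f (insert_perm 0 \<sigma>)) +
     (case b of 0 \<Rightarrow> 0 | Suc b' \<Rightarrow> \<Sum>\<sigma>\<in>unshuffles [a, b', c]. f (insert_perm a \<sigma>)) +
     (case c of 0 \<Rightarrow> 0 | Suc c' \<Rightarrow> \<Sum>\<sigma>\<in>unshuffles [a, b, c']. f (insert_perm (a + b) \<sigma>))"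
proof -
  \<comment> \<open>An empty block starts where the next one does, so demanding nonempty blocks is
    what makes the three classes disjoint.\<close>
  let ?A = "{\<sigma> \<in> unshuffles [a, b, c]. a \<noteq> 0 \<and> \<sigma> 0 = 0}"
    and ?B = "{\<sigma> \<in> unshuffles [a, b, c]. b \<noteq> 0 \<and> \<sigma> a = 0}"
    and ?C = "{\<sigma> \<in> unshuffles [a, b, c]. c \<noteq> 0 \<and> \<sigma> (a + b) = 0}"
  have inj: "i = j" if "\<sigma> \<in> unshuffles [a, b, c]" "\<sigma> i = 0" "\<sigma> j = 0" for \<sigma> i j
  proof -
    from that(1) have "inj \<sigma>" by (auto simp: unshuffles3 intro: permutes_inj)
    then show ?thesis using that injD[of \<sigma> i j] by simp
  qed
  have disj: "?A \<inter> ?B = {}" "(?A \<union> ?B) \<inter> ?C = {}"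
    by (auto dest: inj)
  have fin: "finite ?A" "finite ?B" "finite ?C" "finite (?A \<union> ?B)"
    by (auto intro: finite_subset[OF _ finite_unshuffles])
  have "(\<Sum>\<sigma>\<in>unshuffles [a, b, c]. f \<sigma>) = sum f ?A + sum f ?B + sum f ?C"
    by (subst unshuffles3_cover[OF assms], subst sum.union_disjoint[OF fin(4) fin(3) disj(2)],
        subst sum.union_disjoint[OF fin(1,2) disj(1)]) (rule refl)
  also have "sum f ?A = (case a of 0 \<Rightarrow> 0
      | Suc a' \<Rightarrow> \<Sum>\<sigma>\<in>unshuffles [a', b, c]. f (insert_perm 0 \<sigma>))"
    using sum.reindex_bij_betw[OF unshuffles3_insert_perm(1), of f] by (auto split: nat.split)
  also have "sum f ?B = (case b of 0 \<Rightarrow> 0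
      | Suc b' \<Rightarrow> \<Sum>\<sigma>\<in>unshuffles [a, b', c]. f (insert_perm a \<sigma>))"
    using sum.reindex_bij_betw[OF unshuffles3_insert_perm(2), of f] by (auto split: nat.split)
  also have "sum f ?C = (case c of 0 \<Rightarrow> 0
      | Suc c' \<Rightarrow> \<Sum>\<sigma>\<in>unshuffles [a, b, c']. f (insert_perm (a + b) \<sigma>))"
    using sum.reindex_bij_betw[OF unshuffles3_insert_perm(3), of f] by (auto split: nat.split)
  finally show ?thesis .
qed

lemma map_insert_perm:
  shows "v \<le> s \<Longrightarrow> map (\<lambda>i. (x # xs) ! insert_perm s \<sigma> i) [u..<v] = map (\<lambda>i. xs ! \<sigma> i) [u..<v]"
    and "s \<le> v \<Longrightarrow> map (\<lambda>i. (x # xs) ! insert_perm s \<sigma> i) [s..<Suc v] = x # map (\<lambda>i. xs ! \<sigma> i) [s..<v]"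
    and "s \<le> u \<Longrightarrow> map (\<lambda>i. (x # xs) ! insert_perm s \<sigma> i) [Suc u..<Suc v] = map (\<lambda>i. xs ! \<sigma> i) [u..<v]"
proof -
  show "map (\<lambda>i. (x # xs) ! insert_perm s \<sigma> i) [u..<v] = map (\<lambda>i. xs ! \<sigma> i) [u..<v]" if "v \<le> s"
    using that by (auto simp: insert_perm_def)
  show *: "map (\<lambda>i. (x # xs) ! insert_perm s \<sigma> i) [Suc u..<Suc v] = map (\<lambda>i. xs ! \<sigma> i) [u..<v]"
    if "s \<le> u" for u
    using that unfolding map_Suc_upt[symmetric] map_map
    by (auto simp: insert_perm_def)
  show "map (\<lambda>i. (x # xs) ! insert_perm s \<sigma> i) [s..<Suc v] = x # map (\<lambda>i. xs ! \<sigma> i) [s..<v]" if "s \<le> v"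
    using that *[of s] by (simp add: upt_conv_Cons[of s "Suc v"] insert_perm_def del: upt_Suc)
qed

context vector_space
begin

lemma scale_minus_one_power: "scale ((-1) ^ n) v = signed n v"
  by (simp add: signed_def minus_one_power_iff)

lemma sum_signed: "(\<Sum>i\<in>A. signed n (f i)) = signed n (\<Sum>i\<in>A. f i)"
  by (simp add: signed_def sum_negf)

text \<open>Induction on the list: the head is read where \<sigma> takes the value 0, that is, at
  the start of one of the blocks, so both sides obey the same recursion. The length tests on the
  right pick the prescribed blocks out of all splittings.\<close>

lemma sum_unshuffles3_eq_unshuffle_sum:
  assumes "length xs = a + b + c"
  shows "(\<Sum>\<sigma>\<in>unshuffles [a, b, c]. scale (of_int (sign \<sigma>))
      (H (map (\<lambda>i. xs ! \<sigma> i) [0..<a]) (map (\<lambda>i. xs ! \<sigma> i) [a..<a + b])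
         (map (\<lambda>i. xs ! \<sigma> i) [a + b..<a + b + c]))) =
    unshuffle_sum (\<lambda>u w. unshuffle_sum (\<lambda>u1 u2.
      if length u1 = a \<and> length u2 = b \<and> length w = c then H u1 u2 w else 0) u) xs"
    (is "?S a b c H xs = ?U a b c H xs")
  using assms
proof (induction xs arbitrary: a b c H)
  case Nil
  then have "unshuffles [a, b, c] = {id}"
    by (auto simp: unshuffles3 permutes_id)
  with Nil show ?case by (simp add: sign_id)
next
  case (Cons x xs)
  \<comment> \<open>At the positions \<open>0\<close>, \<open>a\<close> and \<open>a + b\<close>
    used below, \<open>s\<close> counts the entries of the preceding blocks, so this is the sign in
    \<open>unshuffle_sum\<close>.\<close>
  have sgn: "scale (of_int (sign (insert_perm s \<sigma>))) v = signed s (scale (of_int (sign \<sigma>)) v)"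
    if "\<sigma> \<in> unshuffles [a', b', c']" "s \<le> a' + b' + c'" for \<sigma> s v a' b' c'
    using that insert_perm_permutes_sign(2)[of \<sigma> "a' + b' + c'" s]
    by (simp add: unshuffles3 scale_minus_one_power flip: scale_scale)
  have IH: "?S a' b' c' H xs = ?U a' b' c' H xs" if "a' + b' + c' = length xs" for a' b' c' H
    using that by (intro Cons.IH) simp
  have a: "(\<Sum>\<sigma>\<in>unshuffles [a', b, c]. scale (of_int (sign (insert_perm 0 \<sigma>)))
      (H (map (\<lambda>i. (x # xs) ! insert_perm 0 \<sigma> i) [0..<a])
         (map (\<lambda>i. (x # xs) ! insert_perm 0 \<sigma> i) [a..<a + b])
         (map (\<lambda>i. (x # xs) ! insert_perm 0 \<sigma> i) [a + b..<a + b + c]))) =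
      ?U a' b c (\<lambda>u1 u2 w. H (x # u1) u2 w) xs" if "a = Suc a'" for a'
    using that Cons.prems
    by (subst IH[symmetric], simp, intro sum.cong refl) (simp add: sgn map_insert_perm del: upt_Suc)
  have b: "(\<Sum>\<sigma>\<in>unshuffles [a, b', c]. scale (of_int (sign (insert_perm a \<sigma>)))
      (H (map (\<lambda>i. (x # xs) ! insert_perm a \<sigma> i) [0..<a])
         (map (\<lambda>i. (x # xs) ! insert_perm a \<sigma> i) [a..<a + b])
         (map (\<lambda>i. (x # xs) ! insert_perm a \<sigma> i) [a + b..<a + b + c]))) =
      signed a (?U a b' c (\<lambda>u1 u2 w. H u1 (x # u2) w) xs)" if "b = Suc b'" for b'
    using that Cons.prems
    by (subst IH[symmetric], simp, unfold sum_signed[symmetric], intro sum.cong refl)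
      (simp add: sgn map_insert_perm del: upt_Suc)
  have c: "(\<Sum>\<sigma>\<in>unshuffles [a, b, c']. scale (of_int (sign (insert_perm (a + b) \<sigma>)))
      (H (map (\<lambda>i. (x # xs) ! insert_perm (a + b) \<sigma> i) [0..<a])
         (map (\<lambda>i. (x # xs) ! insert_perm (a + b) \<sigma> i) [a..<a + b])
         (map (\<lambda>i. (x # xs) ! insert_perm (a + b) \<sigma> i) [a + b..<a + b + c]))) =
      signed (a + b) (?U a b c' (\<lambda>u1 u2 w. H u1 u2 (x # w)) xs)" if "c = Suc c'" for c'
    using that Cons.prems
    by (subst IH[symmetric], simp, unfold sum_signed[symmetric], intro sum.cong refl)
      (simp add: sgn map_insert_perm del: upt_Suc)
  have "?S a b c H (x # xs) =
     (case a of 0 \<Rightarrow> 0 | Suc a' \<Rightarrow> ?U a' b c (\<lambda>u1 u2 w. H (x # u1) u2 w) xs) +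
     (case b of 0 \<Rightarrow> 0 | Suc b' \<Rightarrow> signed a (?U a b' c (\<lambda>u1 u2 w. H u1 (x # u2) w) xs)) +
     (case c of 0 \<Rightarrow> 0 | Suc c' \<Rightarrow> signed (a + b) (?U a b c' (\<lambda>u1 u2 w. H u1 u2 (x # w)) xs))"
    (is "_ = ?A + ?B + ?C")
  proof (subst sum_unshuffles3, goal_cases)
    case 1
    show ?case using Cons.prems by (intro notI) simp
  next
    case 2
    show ?case
      by (intro arg_cong2[where f = "(+)"] nat.case_cong refl a b c)
  qed
  also have "?A = unshuffle_sum (\<lambda>u w. unshuffle_sum (\<lambda>u1 u2.
      if Suc (length u1) = a \<and> length u2 = b \<and> length w = c then H (x # u1) u2 w else 0) u) xs"
    by (cases a) auto
  also have "?B = unshuffle_sum (\<lambda>u w. unshuffle_sum (\<lambda>u1 u2. signed (length u1) (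
      if length u1 = a \<and> Suc (length u2) = b \<and> length w = c then H u1 (x # u2) w else 0)) u) xs"
    by (cases b) (auto simp flip: unshuffle_sum_signed intro!: unshuffle_sum_cong)
  also have "?C = unshuffle_sum (\<lambda>u w. unshuffle_sum (\<lambda>u1 u2. signed (length u1 + length u2) (
      if length u1 = a \<and> length u2 = b \<and> Suc (length w) = c then H u1 u2 (x # w) else 0)) u) xs"
    by (cases c) (auto simp flip: unshuffle_sum_signed intro!: unshuffle_sum_cong)
  finally show ?case
    unfolding unshuffle_sum_unshuffle_sum_Cons
    by (simp add: unshuffle_sum_add)
qed

end

section \<open>Skew multilinear maps\<close>

text \<open>Separates the last argument, in which a cochain need not be skew, from the
  others.\<close>

definition snoc :: "('a list \<Rightarrow> 'b) \<Rightarrow> 'a list \<Rightarrow> 'a \<Rightarrow> 'b" where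
  "snoc f ys y = f (ys @ [y])"

section \<open>Multilinearity and skew symmetry of coproduct sums and of the product\<close>

locale cochain_space = vector_space scale
  for scale :: "'k::field \<Rightarrow> 'g::ab_group_add \<Rightarrow> 'g"
begin

definition lin :: "('g \<Rightarrow> 'g) \<Rightarrow> bool" where
  "lin f \<longleftrightarrow> (\<forall>x y. f (x + y) = f x + f y) \<and> (\<forall>c x. f (scale c x) = scale c (f x))"

lemma linear_lin: "Vector_Spaces.linear scale scale f \<longleftrightarrow> lin f"
  by (simp add: Vector_Spaces.linear_iff vector_space_axioms lin_def)

lemma lin_additive: "lin f \<Longrightarrow> additive f"
  by (simp add: lin_def additive_def)

lemma lin_zero: "lin (\<lambda>v. 0)"
  by (simp add: lin_def)

lemma lin_add: "lin f \<Longrightarrow> lin g \<Longrightarrow> lin (\<lambda>v. f v + g v)"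
  by (simp add: lin_def scale_right_distrib algebra_simps)

lemma lin_signed: "lin f \<Longrightarrow> lin (\<lambda>v. signed n (f v))"
  by (simp add: lin_def signed_def)

lemma lin_compose: "lin f \<Longrightarrow> lin g \<Longrightarrow> lin (\<lambda>v. f (g v))"
  by (simp add: lin_def)

lemma lin_unshuffle_sum:
  assumes "\<And>b c. lin (\<lambda>v. G v b c)"
  shows "lin (\<lambda>v. unshuffle_sum (G v) xs)"
  using assms
proof (induction xs arbitrary: G)
  case (Cons x xs)
  show ?case unfolding unshuffle_sum.simps
    by (rule Cons.IH) (intro lin_add lin_signed Cons.prems)
qed simp

text \<open>Induction on the entries before the marked one: the marked entry lands in one of the two
  blocks, and the summand is linear there in either case.\<close>

lemma multilinear_unshuffle_sum:
  assumes "\<And>us vs c. lin (\<lambda>v. G (us @ v # vs) c)" and "\<And>us vs b. lin (\<lambda>v. G b (us @ v # vs))"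
  shows "lin (\<lambda>v. unshuffle_sum G (us @ v # vs))"
  using assms
proof (induction us arbitrary: G)
  case Nil
  show ?case
    unfolding append_Nil unshuffle_sum.simps
    by (intro lin_unshuffle_sum lin_add lin_signed Nil[where us = "[]", unfolded append_Nil])
next
  case (Cons u us)
  show ?case unfolding append_Cons unshuffle_sum.simps
  proof (rule Cons.IH)
    show "lin (\<lambda>v. G (u # us @ v # vs) c + signed (length (us @ v # vs)) (G (us @ v # vs) (u # c)))"
      for us vs c
      by (intro lin_add)
        (use Cons.prems(1)[of "u # us" vs c] lin_signed[OF Cons.prems(1)[of us vs "u # c"],
          of "length us + Suc (length vs)"] in simp_all)
    show "lin (\<lambda>v. G (u # b) (us @ v # vs) + signed (length b) (G b (u # us @ v # vs)))"
      for us vs b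
      by (intro lin_add lin_signed Cons.prems)
        (use Cons.prems(2)[of b "u # us" vs] in simp)
  qed
qed

lemma multilinear_skew:
  assumes "\<And>us vs y. lin (\<lambda>v. Q (us @ v # vs) y)" "\<And>ys. lin (Q ys)"
  shows "lin (\<lambda>v. skew Q (us @ v # vs))"
  unfolding skew_def
proof (rule multilinear_unshuffle_sum)
  show "lin (\<lambda>v. if length (us @ v # vs) = 1 then Q b (hd (us @ v # vs)) else 0)" for us vs b
    by (cases us; cases vs) (simp_all add: assms lin_zero)
  show "lin (\<lambda>v. if length c = 1 then Q (us @ v # vs) (hd c) else 0)" for us vs c
    by (cases "length c = 1") (simp_all add: assms lin_zero)
qed

lemma multilinear_circ:
  assumes "\<And>us vs y. lin (\<lambda>v. P (us @ v # vs) y)" "\<And>ys. lin (P ys)"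
    and "\<And>us vs y. lin (\<lambda>v. Q (us @ v # vs) y)" "\<And>ys. lin (Q ys)"
  shows "lin (\<lambda>v. circ P Q (us @ v # vs) y)" "lin (circ P Q ys)"
proof -
  have hd: "lin (\<lambda>v. P (v # c) y)" for c y
    using assms(1)[of "[]"] by simp
  have hd': "lin (\<lambda>v. P (u # us @ v # vs) y)" for u us vs y
    using assms(1)[of "u # us"] by simp
  show "lin (\<lambda>v. circ P Q (us @ v # vs) y)"
    unfolding circ_def
    by (intro multilinear_unshuffle_sum lin_add assms hd' multilinear_skew
      lin_compose[OF hd] lin_compose[OF assms(2)])
  show "lin (circ P Q ys)"
    unfolding circ_def[abs_def]
    by (intro lin_unshuffle_sum lin_add assms lin_compose[OF assms(2)])
qed

end

text \<open>If the two neighbours fall into the same block, skew symmetry of \<open>G\<close>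
  applies. If they separate, their two placements occur with opposite signs, since in one of them an
  entry has passed the other.\<close>

lemma skew_symmetric_unshuffle_sum:
  assumes "\<And>us u v vs c. G (us @ u # v # vs) c = - G (us @ v # u # vs) c"
    and "\<And>us u v vs b. G b (us @ u # v # vs) = - G b (us @ v # u # vs)"
  shows "unshuffle_sum G (us @ u # v # vs) = - unshuffle_sum G (us @ v # u # vs)"
  using assms
proof (induction us arbitrary: G)
  case Nil
  have "G (u # v # b) c = - G (v # u # b) c" "G b (u # v # c) = - G b (v # u # c)" for b c
    using Nil(1)[of "[]" u v b c] Nil(2)[of b "[]" u v c] by simp_all
  then show ?case
    unfolding append_Nil unshuffle_sum.simps unshuffle_sum_minus[symmetric]
    by (intro unshuffle_sum_cong) (auto simp: signed_def)
next
  case (Cons w us)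
  show ?case unfolding append_Cons unshuffle_sum.simps
  proof (rule Cons.IH)
    show "G (w # us @ u # v # vs) c + signed (length (us @ u # v # vs)) (G (us @ u # v # vs) (w # c)) =
       - (G (w # us @ v # u # vs) c + signed (length (us @ v # u # vs)) (G (us @ v # u # vs) (w # c)))"
      for us u v vs c
      using Cons.prems(1)[of "w # us" u v vs c] Cons.prems(1)[of us u v vs "w # c"]
      by (simp add: signed_minus)
    show "G (w # b) (us @ u # v # vs) + signed (length b) (G b (w # us @ u # v # vs)) =
       - (G (w # b) (us @ v # u # vs) + signed (length b) (G b (w # us @ v # u # vs)))"
      for us u v vs b
      using Cons.prems(2)[of b "w # us" u v vs] Cons.prems(2)[of "w # b" us u v vs]
      by (simp add: signed_minus)
  qed
qed

lemma skew_symmetric_skew: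
  assumes "\<And>us u v vs y. Q (us @ u # v # vs) y = - Q (us @ v # u # vs) y"
  shows "skew Q (us @ u # v # vs) = - skew Q (us @ v # u # vs)"
  unfolding skew_def
proof (rule skew_symmetric_unshuffle_sum)
  show "(if length c = 1 then Q (us @ u # v # vs) (hd c) else 0) =
      - (if length c = 1 then Q (us @ v # u # vs) (hd c) else 0)" for us u v vs c
    using assms[of us u v vs "hd c"] by simp
qed simp

lemma skew_symmetric_circ:
  assumes P: "\<And>us u v vs y. P (us @ u # v # vs) y = - P (us @ v # u # vs) y"
    and Q: "\<And>us u v vs y. Q (us @ u # v # vs) y = - Q (us @ v # u # vs) y"
    and lin: "\<And>c y. additive (\<lambda>v. P (v # c) y)" "\<And>c. additive (P c)"
  shows "circ P Q (us @ u # v # vs) y = - circ P Q (us @ v # u # vs) y"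
  unfolding circ_def
proof (rule skew_symmetric_unshuffle_sum)
  show "P (skew Q (us @ u # v # vs) # c) y + P c (Q (us @ u # v # vs) y) =
    - (P (skew Q (us @ v # u # vs) # c) y + P c (Q (us @ v # u # vs) y))" for us u v vs c
    unfolding skew_symmetric_skew[where Q = Q, OF Q, of us u v] Q[of us u v]
     additive.minus[OF lin(1)] additive.minus[OF lin(2)] by simp
  show "P (skew Q b # us @ u # v # vs) y + P (us @ u # v # vs) (Q b y) =
    - (P (skew Q b # us @ v # u # vs) y + P (us @ v # u # vs) (Q b y))" for us u v vs b
    using P[of "skew Q b # us" u v vs] P[of us u v vs] by simp
qed

section \<open>Characteristic different from two\<close>

lemma two_neq_zero:
  assumes "CHAR('k::field) \<noteq> 2"
  shows "(2 :: 'k) \<noteq> 0"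
proof
  assume "(2 :: 'k) = 0"
  then have "of_nat 2 = (0 :: 'k)" by simp
  then have "CHAR('k) dvd 2" by (simp only: of_nat_eq_0_iff_char_dvd)
  then have "CHAR('k) = 1 \<or> CHAR('k) = 2" by (metis prime_nat_iff two_is_prime_nat)
  then show False using assms by auto
qed

lemma (in vector_space) double_eq_zero_iff:
  fixes v :: 'b
  assumes "CHAR('a) \<noteq> 2"
  shows "v + v = 0 \<longleftrightarrow> v = 0"
proof -
  have "v + v = scale 2 v"
    using scale_left_distrib[of 1 1 v] by simp
  then show ?thesis using two_neq_zero[OF assms] by simp
qed

section \<open>Cochains as skew multilinear maps\<close>

context cochain_space
begin

text \<open>A description without arities, so that compositions can be treated without length
  conditions. The requirement \<open>vs \<noteq> []\<close> exempts the last argument from skew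
  symmetry, and the value at the empty list is fixed because \<open>snoc\<close> does not see
  it.\<close>

definition skew_multilinear :: "('g list \<Rightarrow> 'g) \<Rightarrow> bool" where
  "skew_multilinear f \<longleftrightarrow> f [] = 0 \<and> (\<forall>us vs. lin (\<lambda>v. f (us @ v # vs))) \<and>
     (\<forall>us u v vs. vs \<noteq> [] \<longrightarrow> f (us @ u # v # vs) = - f (us @ v # u # vs))"

text \<open>Alternating maps are skew by polarisation at \<open>u + v\<close>, in any
  characteristic.\<close>

lemma cochain_skew_multilinear:
  assumes "f \<in> cochains scale (Suc n)"
  shows "skew_multilinear f"
proof -
  have supp: "f xs = 0" if "length xs \<noteq> Suc n" for xs
    using assms that by (simp add: cochains_def)
  have lin: "lin (\<lambda>v. f (us @ v # vs))" for us vs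
  proof (cases "length us + length vs = n")
    case True
    have "lin (\<lambda>v. f (xs[i := v]))" if "length xs = Suc n" "i < Suc n" for xs i
      using assms that unfolding cochains_def linear_lin by blast
    \<comment> \<open>The entry \<open>0\<close> is a placeholder that the update
      overwrites.\<close>
    from this[of "us @ 0 # vs" "length us"] True show ?thesis by simp
  qed (simp add: supp lin_zero)
  have alt: "f (us @ u # u # vs) = 0" if "vs \<noteq> []" for us u vs
  proof (cases "length us + length vs = n - 1")
    case True
    have "f xs = 0" if "length xs = Suc n" "i < j" "j < n" "xs ! i = xs ! j" for xs i j
      using assms that unfolding cochains_def diff_Suc_1 by blast
    from this[of "us @ u # u # vs" "length us" "Suc (length us)"] True that show ?thesis
      by (cases vs) (auto simp: nth_append)
  qed (use that in \<open>cases vs; simp add: supp\<close>)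
  have skew: "f (us @ u # v # vs) = - f (us @ v # u # vs)" if "vs \<noteq> []" for us u v vs
  proof -
    have add: "f (us @ (x + y) # zs) = f (us @ x # zs) + f (us @ y # zs)"
      "f (us @ z # (x + y) # zs) = f (us @ z # x # zs) + f (us @ z # y # zs)" for x y z zs
      using additive.add[OF lin_additive[OF lin[of us zs]]]
        additive.add[OF lin_additive[OF lin[of "us @ [z]" zs]]] by simp_all
    have "f (us @ (u + v) # (u + v) # vs) = f (us @ u # u # vs) + f (us @ u # v # vs)
        + (f (us @ v # u # vs) + f (us @ v # v # vs))"
      by (simp only: add add_ac)
    then have "f (us @ u # v # vs) + f (us @ v # u # vs) = 0"
      using alt[OF that, of us u] alt[OF that, of us v] alt[OF that, of us "u + v"] by simp
    then show ?thesis by (simp add: eq_neg_iff_add_eq_0)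
  qed
  have "f [] = 0" by (simp add: supp)
  with lin skew show ?thesis unfolding skew_multilinear_def by blast
qed

text \<open>Skew symmetry moves two equal arguments next to each other, where it makes twice the
  value 0; here the characteristic enters.\<close>

lemma skew_multilinear_cochain:
  assumes char: "CHAR('k) \<noteq> 2"
    and f: "skew_multilinear f" and supp: "\<And>xs. length xs \<noteq> Suc n \<Longrightarrow> f xs = 0"
  shows "f \<in> cochains scale (Suc n)"
proof -
  have lin: "lin (\<lambda>v. f (us @ v # vs))" for us vs
    using f unfolding skew_multilinear_def by blast
  have skew: "f (us @ u # v # vs) = - f (us @ v # u # vs)" if "vs \<noteq> []" for us u v vs
    using f that unfolding skew_multilinear_def by blast
  have alt: "f (us @ u # ms @ u # vs) = 0" if "vs \<noteq> []" for us u ms vs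
  proof (induction ms arbitrary: us)
    case Nil
    have "f (us @ u # u # vs) + f (us @ u # u # vs) = 0"
      using skew[OF that, of us u u] by (simp add: eq_neg_iff_add_eq_0)
    then show ?case
      by (simp add: double_eq_zero_iff[OF char])
  next
    case (Cons m ms)
    have "f (us @ u # m # (ms @ u # vs)) = - f (us @ m # u # (ms @ u # vs))"
      by (rule skew) simp
    with Cons[of "us @ [m]"] show ?case by simp
  qed
  have "f xs = 0" if "length xs = Suc n" "i < j" "j < n" "xs ! i = xs ! j" for xs i j
  proof -
    have "xs = take i xs @ xs ! i # drop (Suc i) xs"
      by (rule id_take_nth_drop) (use that in simp)
    also have "drop (Suc i) xs = take (j - Suc i) (drop (Suc i) xs) @ xs ! j # drop (Suc j) xs"
      using that id_take_nth_drop[of "j - Suc i" "drop (Suc i) xs"] by simp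
    finally have "f xs = f (take i xs @ xs ! i # take (j - Suc i) (drop (Suc i) xs) @ xs ! i # drop (Suc j) xs)"
      using that by simp
    \<comment> \<open>Since \<open>j < n\<close>, some entry follows position \<open>j\<close>, so
      neither of the equal arguments is the last one.\<close>
    also have "\<dots> = 0" by (rule alt) (use that in simp)
    finally show ?thesis .
  qed
  moreover have "lin (\<lambda>v. f (xs[i := v]))" if "i < length xs" for xs i
    using lin that by (simp add: upd_conv_take_nth_drop)
  ultimately show ?thesis
    using supp by (auto simp: cochains_def linear_lin)
qed

lemma
  assumes "skew_multilinear P"
  shows skew_multilinear_lin: "lin (\<lambda>v. snoc P (us @ v # vs) y)" "lin (\<lambda>v. snoc P (v # vs) y)"
      "lin (snoc P ys)"
    and skew_multilinear_skew: "snoc P (us @ u # v # vs) y = - snoc P (us @ v # u # vs) y"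
proof -
  have 1: "lin (\<lambda>v. P (us @ v # vs))" for us vs
    using assms unfolding skew_multilinear_def by blast
  have 2: "P (us @ u # v # vs) = - P (us @ v # u # vs)" if "vs \<noteq> []" for us u v vs
    using assms that unfolding skew_multilinear_def by blast
  show "lin (\<lambda>v. snoc P (us @ v # vs) y)" "lin (\<lambda>v. snoc P (v # vs) y)" "lin (snoc P ys)"
    using 1[of us "vs @ [y]"] 1[of "[]" "vs @ [y]"] 1[of ys "[]"] by (simp_all add: snoc_def[abs_def])
  show "snoc P (us @ u # v # vs) y = - snoc P (us @ v # u # vs) y"
    using 2[of "vs @ [y]" us u v] by (simp add: snoc_def)
qed

text \<open>Only \<open>snoc f\<close> is given, so a position is treated according to whether it is
  the last one, and the value at the empty list has to be supplied.\<close>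

lemma skew_multilinear_circ:
  assumes P: "skew_multilinear P" and Q: "skew_multilinear Q" and "f [] = 0"
    and f: "snoc f = circ (snoc P) (snoc Q)"
  shows "skew_multilinear f"
proof -
  note lin = multilinear_circ[OF skew_multilinear_lin(1,3)[OF P] skew_multilinear_lin(1,3)[OF Q]]
  note skew = skew_symmetric_circ[where P = "snoc P" and Q = "snoc Q",
    OF skew_multilinear_skew[OF P] skew_multilinear_skew[OF Q]
    skew_multilinear_lin(2,3)[OF P, THEN lin_additive]]
  have *: "f (ys @ [y]) = circ (snoc P) (snoc Q) ys y" for ys y
    by (simp flip: f add: snoc_def)
  show ?thesis
    unfolding skew_multilinear_def
  proof (intro conjI allI impI)
    show "lin (\<lambda>v. f (us @ v # vs))" for us vs
    proof (cases vs rule: rev_cases)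
      case Nil
      then show ?thesis using * lin(2) by simp
    next
      case (snoc ws y)
      then show ?thesis using *[of "us @ _ # ws" y] lin(1) by simp
    qed
    show "f (us @ u # v # vs) = - f (us @ v # u # vs)" if "vs \<noteq> []" for us u v vs
    proof -
      from that obtain ws y where "vs = ws @ [y]" by (cases vs rule: rev_cases) auto
      then show ?thesis
        using *[of "us @ u # v # ws" y] *[of "us @ v # u # ws" y] skew[of us u v ws y] by simp
    qed
  qed (rule assms)
qed

end

section \<open>Twisting a graded Lie algebra by elements of degree one\<close>

context graded_vector_space
begin

lemma component_total: "x \<in> G i \<Longrightarrow> x \<in> total"
  unfolding total_def by (rule span_base) blast

lemma subspace_total: "subspace total"
  unfolding total_def by (rule subspace_span)

text \<open>Scalar multiples are absorbed by the components, which leaves only sums to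
  consider.\<close>

lemma total_induct [consumes 1, case_names component add]:
  assumes "x \<in> total" and "\<And>i x. x \<in> G i \<Longrightarrow> P x"
    and "\<And>x y. x \<in> total \<Longrightarrow> y \<in> total \<Longrightarrow> P x \<Longrightarrow> P y \<Longrightarrow> P (x + y)"
  shows "P x"
proof -
  have "x \<in> total \<and> P x"
    using assms(1) unfolding total_def
  proof (induction rule: span_induct_alt)
    case base
    show ?case using assms(2)[OF subspace_0[OF subspace_component]] by (simp add: span_zero)
  next
    case (step c x y)
    from step(1) obtain i where "x \<in> G i" by blast
    then have "scale c x \<in> G i" by (rule subspace_scale[OF subspace_component])
    then show ?case
      using step(2) assms(2,3) component_total subspace_add[OF subspace_total]
      by (auto simp: total_def)
  qed
  then show ?thesis ..
qed

end

context graded_lie_algebra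
begin

lemma br_total:
  assumes "x \<in> total" "y \<in> total"
  shows "br x y \<in> total"
  using assms(1)
proof (induction rule: total_induct)
  case (component i x)
  show ?case using assms(2)
  proof (induction rule: total_induct)
    case (component j y)
    with \<open>x \<in> G i\<close> show ?case by (blast intro: component_total br_degree)
  next
    case (add y z)
    then show ?case
      using \<open>x \<in> G i\<close> by (simp add: component_total br_add_right subspace_add[OF subspace_total])
  qed
next
  case (add x z)
  then show ?case using assms(2) by (simp add: br_add_left subspace_add[OF subspace_total])
qed

lemma br_0_left: "x \<in> total \<Longrightarrow> br 0 x = 0"
  using br_scale_left[of 0 x 0] subspace_0[OF subspace_total] by simp

lemma br_symmetric: "x \<in> G 1 \<Longrightarrow> y \<in> G 1 \<Longrightarrow> br y x = br x y"
  using br_skew[of x 1 y 1] by simp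

text \<open>In degree one the Jacobi identity reads [p, [q, x]] = [[p, q], x] - [q, [p, x]], and its
  first term vanishes. The case p = q gives twice the square of a differential.\<close>

lemma br_br_anticommute:
  assumes p: "p \<in> G 1" and q: "q \<in> G 1" and pq: "br p q = 0" and x: "x \<in> total"
  shows "br p (br q x) + br q (br p x) = 0"
  using x
proof (induction rule: total_induct)
  case (component i x)
  then show ?case
    using br_jacobi[OF p q component] pq by (simp add: br_0_left component_total)
next
  case (add x y)
  have eq: "br p (br q (x + y)) + br q (br p (x + y)) =
    (br p (br q x) + br q (br p x)) + (br p (br q y) + br q (br p y))"
    using add(1,2) p q by (simp add: br_add_right br_total component_total)
  show ?case unfolding eq add(3,4) by simp
qed

text \<open>The square vanishes after halving, and the derivation rule is the Jacobi identity with
  \<open>p\<close> in degree one.\<close>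

lemma br_differential:
  assumes "CHAR('k) \<noteq> 2" and p: "p \<in> G 1" "br p p = 0"
  shows "differential_graded_lie_algebra scale G br (br p)"
proof unfold_locales
  show "br p (br p x) = 0" if "x \<in> total" for x
    using br_br_anticommute[OF p(1) p(1) p(2) that]
    by (simp add: double_eq_zero_iff[OF assms(1)])
  show "br p (br x y) = br (br p x) y + scale ((- 1) ^ i) (br x (br p y))"
    if "x \<in> G i" "y \<in> G j" for x y i j
    using br_jacobi[OF p(1) that] by simp
qed (use p br_degree[OF p(1)] in \<open>auto simp: br_add_right br_scale_right component_total\<close>)

lemma br_bidifferential:
  assumes "CHAR('k) \<noteq> 2" and "p \<in> G 1" "br p p = 0" and "q \<in> G 1" "br q q = 0" and "br p q = 0"
  shows "bidifferential_graded_lie_algebra scale G br (br p) (br q)"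
proof -
  interpret p: differential_graded_lie_algebra scale G br "br p"
    by (rule br_differential) (use assms in auto)
  interpret q: differential_graded_lie_algebra scale G br "br q"
    by (rule br_differential) (use assms in auto)
  show ?thesis
    by unfold_locales (use assms in \<open>blast intro: br_br_anticommute\<close>)
qed

text \<open>The bracket is symmetric in degree one, so [p + P, p + P] is twice [p, P] + 1/2 [P, P]
  once [p, p] = 0. The mixed bracket expands directly to the third equation.\<close>

lemma maurer_cartan_pair_iff:
  assumes "CHAR('k) \<noteq> 2" and p: "p \<in> G 1" "br p p = 0" and q: "q \<in> G 1" "br q q = 0"
    and pq: "br p q = 0" and P: "P \<in> G 1" and Q: "Q \<in> G 1"
  shows "maurer_cartan_pair scale G br (br p) (br q) P Q \<longleftrightarrow>
    br (p + P) (p + P) = 0 \<and> br (q + Q) (q + Q) = 0 \<and> br (p + P) (q + Q) = 0"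
proof -
  have expand: "br (a + b) (c + d) = br a c + br a d + br b c + br b d"
    if "a \<in> G 1" "b \<in> G 1" "c \<in> G 1" "d \<in> G 1" for a b c d
    using that by (simp add: br_add_left br_add_right component_total subspace_add[OF subspace_total])
  have two: "v + v = 0 \<longleftrightarrow> v = 0" for v :: 'v
    by (rule double_eq_zero_iff[OF assms(1)])
  have half: "scale (1 / 2) v + scale (1 / 2) v = v" for v
    using two_neq_zero[OF assms(1)] by (simp flip: scale_left_distrib)
  have diag: "br (a + b) (a + b) = 0 \<longleftrightarrow> br a b + scale (1 / 2) (br b b) = 0"
    if "a \<in> G 1" "b \<in> G 1" "br a a = 0" for a b
  proof -
    have "br (a + b) (a + b) = (br a b + scale (1 / 2) (br b b)) + (br a b + scale (1 / 2) (br b b))"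
      using that half[of "br b b"] by (simp add: expand br_symmetric[of a b] algebra_simps)
    then show ?thesis by (simp only: two)
  qed
  have "br (p + P) (q + Q) = br p Q + br q P + br P Q"
    using assms by (simp add: expand br_symmetric[of q P])
  then show ?thesis
    using assms by (simp add: maurer_cartan_pair_def diag)
qed

end

section \<open>The Matsushima-Nijenhuis bracket\<close>

context cochain_space
begin

lemma cochain_degree_vanish: "f \<in> cochain_degree scale p \<Longrightarrow> length xs \<noteq> Suc p \<Longrightarrow> f xs = 0"
  by (simp add: cochain_degree_def cochains_def)

lemma cochain_degree_skew_multilinear: "f \<in> cochain_degree scale p \<Longrightarrow> skew_multilinear f"
  by (simp add: cochain_degree_def cochain_skew_multilinear)

lemma cochain_degreeI:
  assumes "CHAR('k) \<noteq> 2" "skew_multilinear f" "\<And>xs. length xs \<noteq> Suc p \<Longrightarrow> f xs = 0"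
  shows "f \<in> cochain_degree scale p"
  using skew_multilinear_cochain[OF assms] by (simp add: cochain_degree_def)

section \<open>The unshuffle formula as a coproduct sum\<close>

lemma map_append_nth_unshuffle:
  assumes "\<sigma> \<in> unshuffles bs" "length ys = sum_list bs" "v \<le> sum_list bs"
  shows "map (\<lambda>i. (ys @ zs) ! \<sigma> i) [u..<v] = map (\<lambda>i. ys ! \<sigma> i) [u..<v]"
proof (rule map_cong[OF refl])
  fix i assume "i \<in> set [u..<v]"
  then have "\<sigma> i < sum_list bs"
    using assms permutes_in_image[of \<sigma> "{0..<sum_list bs}" i] by (simp add: unshuffles_def)
  then show "(ys @ zs) ! \<sigma> i = ys ! \<sigma> i" using assms by (simp add: nth_append)
qed

text \<open>The three blocks hold the skew arguments of \<open>Q\<close>, its last argument and the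
  remaining skew arguments of \<open>P\<close>; summing over the divisions of the first two gives
  \<open>skew (snoc Q)\<close>. The degree of \<open>P\<close> is written \<open>Suc p\<close> since
  the sum is absent in degree 0.\<close>

lemma mn_circ_first_sum:
  assumes P: "P \<in> cochain_degree scale (Suc p)" and Q: "Q \<in> cochain_degree scale q"
    and ys: "length ys = Suc p + q"
  shows "(\<Sum>\<sigma>\<in>unshuffles [q, 1, p]. scale (of_int (sign \<sigma>))
            (P (Q (map (\<lambda>i. (ys @ [y]) ! \<sigma> i) [0..<q + 1]) #
                map (\<lambda>i. (ys @ [y]) ! \<sigma> i) [q + 1..<Suc p + q] @ [(ys @ [y]) ! (Suc p + q)])))
    = unshuffle_sum (\<lambda>b c. snoc P (skew (snoc Q) b # c) y) ys"
proof -
  let ?H = "\<lambda>u1 u2 w. P (Q (u1 @ u2) # w @ [y])"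
  have "(\<Sum>\<sigma>\<in>unshuffles [q, 1, p]. scale (of_int (sign \<sigma>))
            (P (Q (map (\<lambda>i. (ys @ [y]) ! \<sigma> i) [0..<q + 1]) #
                map (\<lambda>i. (ys @ [y]) ! \<sigma> i) [q + 1..<Suc p + q] @ [(ys @ [y]) ! (Suc p + q)])))
      = (\<Sum>\<sigma>\<in>unshuffles [q, 1, p]. scale (of_int (sign \<sigma>))
      (?H (map (\<lambda>i. ys ! \<sigma> i) [0..<q]) (map (\<lambda>i. ys ! \<sigma> i) [q..<q + 1])
         (map (\<lambda>i. ys ! \<sigma> i) [q + 1..<q + 1 + p])))"
  proof (intro sum.cong refl)
    fix \<sigma> assume \<sigma>: "\<sigma> \<in> unshuffles [q, 1, p]"
    have "(ys @ [y]) ! (Suc p + q) = y"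
      using ys by (metis nth_append_length)
    moreover have "map (\<lambda>i. (ys @ [y]) ! \<sigma> i) [0..<q + 1] =
        map (\<lambda>i. ys ! \<sigma> i) [0..<q] @ map (\<lambda>i. ys ! \<sigma> i) [q..<q + 1]"
      using ys by (subst map_append_nth_unshuffle[OF \<sigma>]) simp_all
    moreover have "map (\<lambda>i. (ys @ [y]) ! \<sigma> i) [q + 1..<Suc p + q] =
        map (\<lambda>i. ys ! \<sigma> i) [q + 1..<q + 1 + p]"
      using ys by (subst map_append_nth_unshuffle[OF \<sigma>]) (simp_all add: add_ac)
    ultimately show "scale (of_int (sign \<sigma>))
            (P (Q (map (\<lambda>i. (ys @ [y]) ! \<sigma> i) [0..<q + 1]) #
                map (\<lambda>i. (ys @ [y]) ! \<sigma> i) [q + 1..<Suc p + q] @ [(ys @ [y]) ! (Suc p + q)])) =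
        scale (of_int (sign \<sigma>))
          (?H (map (\<lambda>i. ys ! \<sigma> i) [0..<q]) (map (\<lambda>i. ys ! \<sigma> i) [q..<q + 1])
         (map (\<lambda>i. ys ! \<sigma> i) [q + 1..<q + 1 + p]))"
      by (simp only:)
  qed
  also have "\<dots> = unshuffle_sum (\<lambda>u w. unshuffle_sum (\<lambda>u1 u2.
      if length u1 = q \<and> length u2 = 1 \<and> length w = p then ?H u1 u2 w else 0) u) ys"
    by (rule sum_unshuffles3_eq_unshuffle_sum) (use ys in simp)
  also have "\<dots> = unshuffle_sum (\<lambda>b c. snoc P (skew (snoc Q) b # c) y) ys"
  proof (rule unshuffle_sum_cong)
    fix u w
    have P0: "snoc P (0 # w) y = 0"
      using additive.zero[OF lin_additive[OF skew_multilinear_lin(2)[OF cochain_degree_skew_multilinear[OF P]]]] .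
    have "snoc P (skew (snoc Q) u # w) y = unshuffle_sum (\<lambda>u1 u2.
        snoc P ((if length u2 = 1 then snoc Q u1 (hd u2) else 0) # w) y) u"
      unfolding skew_def
      by (rule unshuffle_sum_additive lin_additive skew_multilinear_lin(2) cochain_degree_skew_multilinear P)+
    \<comment> \<open>Blocks of other lengths contribute 0 by the arities of \<open>P\<close> and
      \<open>Q\<close>, so the length tests change nothing.\<close>
    also have "\<dots> = unshuffle_sum (\<lambda>u1 u2.
      if length u1 = q \<and> length u2 = 1 \<and> length w = p then ?H u1 u2 w else 0) u"
    proof (rule unshuffle_sum_cong)
      fix u1 u2 :: "'g list"
      show "snoc P ((if length u2 = 1 then snoc Q u1 (hd u2) else 0) # w) y =
        (if length u1 = q \<and> length u2 = 1 \<and> length w = p then ?H u1 u2 w else 0)"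
        using cochain_degree_vanish[OF P, of "_ # w @ [y]"] cochain_degree_vanish[OF Q, of "u1 @ u2"] P0
        by (cases u2) (auto simp: snoc_def)
    qed
    finally show "unshuffle_sum (\<lambda>u1 u2.
      if length u1 = q \<and> length u2 = 1 \<and> length w = p then ?H u1 u2 w else 0) u =
      snoc P (skew (snoc Q) u # w) y" ..
  qed
  finally show ?thesis .
qed

text \<open>The factor (-1)^(p * q) is the sign of moving the block of \<open>Q\<close> in front of
  the block of \<open>P\<close>, so it cancels in the order used by \<open>circ\<close>.\<close>

lemma mn_circ_second_sum:
  assumes P: "P \<in> cochain_degree scale p" and Q: "Q \<in> cochain_degree scale q"
    and ys: "length ys = p + q"
  shows "scale ((-1) ^ (p * q)) (\<Sum>\<sigma>\<in>unshuffles [p, q]. scale (of_int (sign \<sigma>))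
            (P (map (\<lambda>i. (ys @ [y]) ! \<sigma> i) [0..<p] @
                [Q (map (\<lambda>i. (ys @ [y]) ! \<sigma> i) [p..<p + q] @ [(ys @ [y]) ! (p + q)])])))
    = unshuffle_sum (\<lambda>b c. snoc P c (snoc Q b y)) ys"
proof -
  let ?H = "\<lambda>u1 u2 w. P (u1 @ [Q (u2 @ [y])])"
  have "(\<Sum>\<sigma>\<in>unshuffles [p, q]. scale (of_int (sign \<sigma>))
            (P (map (\<lambda>i. (ys @ [y]) ! \<sigma> i) [0..<p] @
                [Q (map (\<lambda>i. (ys @ [y]) ! \<sigma> i) [p..<p + q] @ [(ys @ [y]) ! (p + q)])])))
      = (\<Sum>\<sigma>\<in>unshuffles [p, q, 0]. scale (of_int (sign \<sigma>))
      (?H (map (\<lambda>i. ys ! \<sigma> i) [0..<p]) (map (\<lambda>i. ys ! \<sigma> i) [p..<p + q])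
         (map (\<lambda>i. ys ! \<sigma> i) [p + q..<p + q + 0])))"
    unfolding unshuffles2
  proof (intro sum.cong refl)
    fix \<sigma> assume \<sigma>: "\<sigma> \<in> unshuffles [p, q, 0]"
    have "(ys @ [y]) ! (p + q) = y"
      using ys by (metis nth_append_length)
    moreover have "map (\<lambda>i. (ys @ [y]) ! \<sigma> i) [0..<p] = map (\<lambda>i. ys ! \<sigma> i) [0..<p]"
      "map (\<lambda>i. (ys @ [y]) ! \<sigma> i) [p..<p + q] = map (\<lambda>i. ys ! \<sigma> i) [p..<p + q]"
      using ys by (simp_all add: map_append_nth_unshuffle[OF \<sigma>])
    ultimately show "scale (of_int (sign \<sigma>))
            (P (map (\<lambda>i. (ys @ [y]) ! \<sigma> i) [0..<p] @
                [Q (map (\<lambda>i. (ys @ [y]) ! \<sigma> i) [p..<p + q] @ [(ys @ [y]) ! (p + q)])])) =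
        scale (of_int (sign \<sigma>))
          (?H (map (\<lambda>i. ys ! \<sigma> i) [0..<p]) (map (\<lambda>i. ys ! \<sigma> i) [p..<p + q])
         (map (\<lambda>i. ys ! \<sigma> i) [p + q..<p + q + 0]))"
      by (simp only:)
  qed
  also have "\<dots> = unshuffle_sum (\<lambda>u w. unshuffle_sum (\<lambda>u1 u2.
      if length u1 = p \<and> length u2 = q \<and> length w = 0 then ?H u1 u2 w else 0) u) ys"
    by (rule sum_unshuffles3_eq_unshuffle_sum) (use ys in simp)
  also have "\<dots> = unshuffle_sum (\<lambda>u w. if w = [] then unshuffle_sum (\<lambda>u1 u2.
      if length u1 = p \<and> length u2 = q then P (u1 @ [Q (u2 @ [y])]) else 0) u else 0) ys"
    by (rule unshuffle_sum_cong) simp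
  also have "\<dots> = unshuffle_sum (\<lambda>u1 u2.
      if length u1 = p \<and> length u2 = q then P (u1 @ [Q (u2 @ [y])]) else 0) ys"
    by (rule unshuffle_sum_Nil_right)
  also have "\<dots> = unshuffle_sum (\<lambda>b c. signed (p * q) (snoc P c (snoc Q b y))) ys"
  proof (subst unshuffle_sum_commute, rule unshuffle_sum_cong)
    fix b c :: "'g list"
    have "snoc P c 0 = 0"
      using additive.zero[OF lin_additive[OF skew_multilinear_lin(3)[OF cochain_degree_skew_multilinear[OF P]]]] .
    then show "signed (length b * length c)
        (if length c = p \<and> length b = q then P (c @ [Q (b @ [y])]) else 0) =
      signed (p * q) (snoc P c (snoc Q b y))"
      using cochain_degree_vanish[OF P, of "c @ [Q (b @ [y])]"] cochain_degree_vanish[OF Q, of "b @ [y]"]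
      by (auto simp: snoc_def mult.commute)
  qed
  \<comment> \<open>The sign now occurs twice, with the even exponent
    \<open>p * q + p * q\<close>.\<close>
  finally show ?thesis
    by (simp add: scale_minus_one_power unshuffle_sum_signed signed_parity[where n = 0])
qed

text \<open>The link between the unshuffle formula and the sign-free product, through which the
  associator results reach the bracket.\<close>

lemma mn_circ_snoc:
  assumes P: "P \<in> cochain_degree scale p" and Q: "Q \<in> cochain_degree scale q"
  shows "snoc (mn_circ scale p q P Q) = circ (snoc P) (snoc Q)"
proof (intro ext)
  fix ys y
  have P0: "snoc P (0 # c) y = 0" "snoc P c 0 = 0" for c y
    using additive.zero[OF lin_additive[OF skew_multilinear_lin(2)[OF cochain_degree_skew_multilinear[OF P]]]]
      additive.zero[OF lin_additive[OF skew_multilinear_lin(3)[OF cochain_degree_skew_multilinear[OF P]]]] .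
  have Pl: "snoc P c y = 0" if "length c \<noteq> p" for c y
    using cochain_degree_vanish[OF P, of "c @ [y]"] that by (simp add: snoc_def)
  have Ql: "snoc Q c y = 0" if "length c \<noteq> q" for c y
    using cochain_degree_vanish[OF Q, of "c @ [y]"] that by (simp add: snoc_def)
  show "snoc (mn_circ scale p q P Q) ys y = circ (snoc P) (snoc Q) ys y"
  proof (cases "length ys = p + q")
    case True
    have first: "(if p = 0 then 0 else
       (\<Sum>\<sigma>\<in>unshuffles [q, 1, p - 1]. scale (of_int (sign \<sigma>))
            (P (Q (map (\<lambda>i. (ys @ [y]) ! \<sigma> i) [0..<q + 1]) #
                map (\<lambda>i. (ys @ [y]) ! \<sigma> i) [q + 1..<p + q] @ [(ys @ [y]) ! (p + q)]))))
      = unshuffle_sum (\<lambda>b c. snoc P (skew (snoc Q) b # c) y) ys"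
    proof (cases p)
      case 0
      \<comment> \<open>In degree 0 \<open>snoc P\<close> vanishes on every nonempty list of skew
        arguments, which matches the empty first sum.\<close>
      then show ?thesis by (simp add: Pl)
    next
      case (Suc p')
      then show ?thesis using mn_circ_first_sum[of P p' Q q ys y] P Q True by simp
    qed
    show ?thesis
      unfolding snoc_def[of "mn_circ scale p q P Q"] mn_circ_def first mn_circ_second_sum[OF P Q True]
      using True by (simp add: circ_def unshuffle_sum_add)
  next
    case False
    have "circ (snoc P) (snoc Q) ys y = unshuffle_sum (\<lambda>_ _. 0) ys"
      unfolding circ_def
    proof (rule unshuffle_sum_cong)
      fix b c :: "'g list" assume "length b + length c = length ys"
      then show "snoc P (skew (snoc Q) b # c) y + snoc P c (snoc Q b y) = 0"
        using False Pl[of "skew (snoc Q) b # c"] skew_eq_0[of q "snoc Q" b] Ql Pl[of c] P0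
        by (cases "length b = Suc q"; cases "length b = q") auto
    qed
    then show ?thesis using False by (simp add: snoc_def mn_circ_def)
  qed
qed

lemma mn_circ_cochain_degree:
  assumes char: "CHAR('k) \<noteq> 2"
    and P: "P \<in> cochain_degree scale p" and Q: "Q \<in> cochain_degree scale q"
  shows "mn_circ scale p q P Q \<in> cochain_degree scale (p + q)"
proof (rule cochain_degreeI[OF char])
  show "skew_multilinear (mn_circ scale p q P Q)"
    by (rule skew_multilinear_circ[OF cochain_degree_skew_multilinear[OF P]
        cochain_degree_skew_multilinear[OF Q] _ mn_circ_snoc[OF P Q]]) (simp add: mn_circ_def)
qed (simp add: mn_circ_def)

text \<open>Each difference is an associator by \<open>circ_circ\<close>, so this is
  \<open>associator_commute\<close> carried over to cochains.\<close>

lemma mn_circ_right_symmetric: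
  assumes char: "CHAR('k) \<noteq> 2" and P: "P \<in> cochain_degree scale p"
    and Q: "Q \<in> cochain_degree scale q" and R: "R \<in> cochain_degree scale r"
  shows "mn_circ scale (p + r) q (mn_circ scale p r P R) Q - mn_circ scale p (r + q) P (mn_circ scale r q R Q)
    = signed (q * r)
       (mn_circ scale (p + q) r (mn_circ scale p q P Q) R - mn_circ scale p (q + r) P (mn_circ scale q r Q R))"
    (is "?f = signed _ ?g")
proof
  fix xs
  note add = skew_multilinear_lin(2,3)[OF cochain_degree_skew_multilinear, THEN lin_additive]
  note mem = P Q R mn_circ_cochain_degree[OF char]
  have assoc: "snoc (mn_circ scale (p + q) r (mn_circ scale p q P Q) R - mn_circ scale p (q + r) P (mn_circ scale q r Q R)) ys y
      = associator (snoc P) (snoc Q) (snoc R) ys y"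
    if Q: "Q \<in> cochain_degree scale q" and R: "R \<in> cochain_degree scale r" for Q R q r ys y
  proof -
    have "snoc (mn_circ scale (p + q) r (mn_circ scale p q P Q) R) ys y =
       circ (circ (snoc P) (snoc Q)) (snoc R) ys y"
      using mn_circ_snoc[OF P Q] mn_circ_snoc[OF mn_circ_cochain_degree[OF char P Q] R] by simp
    moreover have "snoc (mn_circ scale p (q + r) P (mn_circ scale q r Q R)) ys y =
       circ (snoc P) (circ (snoc Q) (snoc R)) ys y"
      using mn_circ_snoc[OF Q R] mn_circ_snoc[OF P mn_circ_cochain_degree[OF char Q R]] by simp
    ultimately show ?thesis
      using circ_circ[where P = "snoc P" and Q = "snoc Q" and R = "snoc R" and ys = ys and y = y,
        OF add[OF P] add(2)[OF Q]] by (simp add: snoc_def)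
  qed
  show "?f xs = signed (q * r) ?g xs"
  proof (cases xs rule: rev_cases)
    \<comment> \<open>The empty list has no last argument to split off, but every composition
      vanishes on it.\<close>
    case Nil
    then show ?thesis by (simp add: mn_circ_def signed_def)
  next
    case (snoc ys y)
    have "snoc ?f ys y = signed (q * r) (snoc ?g ys y)"
      unfolding assoc[OF Q R] assoc[OF R Q]
    proof (rule associator_commute[OF add[OF P]])
      show "snoc P (u # v # c) y = - snoc P (v # u # c) y" for u v c y
        using skew_multilinear_skew[OF cochain_degree_skew_multilinear[OF P], of "[]" u v c y] by simp
    qed (simp_all add: snoc_def cochain_degree_vanish[OF Q] cochain_degree_vanish[OF R])
    then show ?thesis using snoc by (simp add: snoc_def signed_def)
  qed
qed

section \<open>Bilinearity of the bracket and the grading\<close>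

lemma mn_circ_add_left: "mn_circ scale p q (P + P') Q = mn_circ scale p q P Q + mn_circ scale p q P' Q"
  by (rule ext) (simp add: mn_circ_def sum.distrib scale_right_distrib algebra_simps)

lemma mn_circ_scale_left:
  "mn_circ scale p q (cochain_scale scale c P) Q = cochain_scale scale c (mn_circ scale p q P Q)"
  by (rule ext) (simp add: mn_circ_def cochain_scale_def scale_sum_right scale_right_distrib mult_ac)

text \<open>Linearity in each argument is what expanding a composition in its inner factor uses; it
  passes to sums of different degrees and so holds on the whole direct sum.\<close>

definition multilinear :: "('g list \<Rightarrow> 'g) \<Rightarrow> bool" where
  "multilinear f \<longleftrightarrow> (\<forall>us vs. lin (\<lambda>v. f (us @ v # vs)))"

lemma skew_multilinear_multilinear: "skew_multilinear f \<Longrightarrow> multilinear f"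
  unfolding skew_multilinear_def multilinear_def by blast

lemma
  assumes "multilinear P"
  shows mn_circ_add_right: "mn_circ scale p q P (Q + Q') = mn_circ scale p q P Q + mn_circ scale p q P Q'"
    and mn_circ_scale_right:
      "mn_circ scale p q P (cochain_scale scale c Q) = cochain_scale scale c (mn_circ scale p q P Q)"
proof -
  have lin: "lin (\<lambda>v. P (us @ v # vs))" for us vs
    using assms by (simp add: multilinear_def)
  have add: "P ((x + y) # vs) = P (x # vs) + P (y # vs)" "P (us @ [x + y]) = P (us @ [x]) + P (us @ [y])"
    for x y us vs
    using lin[of "[]" vs] lin[of us "[]"] by (simp_all add: lin_def)
  have scale: "P (scale c x # vs) = scale c (P (x # vs))" "P (us @ [scale c x]) = scale c (P (us @ [x]))"
    for x us vs
    using lin[of "[]" vs] lin[of us "[]"] by (simp_all add: lin_def)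
  show "mn_circ scale p q P (Q + Q') = mn_circ scale p q P Q + mn_circ scale p q P Q'"
    by (rule ext) (simp add: mn_circ_def add sum.distrib scale_right_distrib algebra_simps)
  show "mn_circ scale p q P (cochain_scale scale c Q) = cochain_scale scale c (mn_circ scale p q P Q)"
    by (rule ext) (simp add: mn_circ_def cochain_scale_def scale scale_sum_right scale_right_distrib mult_ac)
qed

lemma vector_space_cochain_scale: "vector_space (cochain_scale scale)"
  by unfold_locales (auto simp: cochain_scale_def fun_eq_iff scale_right_distrib scale_left_distrib)

lemma graded_vector_space_cochain_degree:
  "graded_vector_space (cochain_scale scale) (cochain_degree scale)"
proof -
  interpret cochain: vector_space "cochain_scale scale" by (rule vector_space_cochain_scale)
  show ?thesis
  proof unfold_locales
    show "cochain.subspace (cochain_degree scale i)" for i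
      unfolding cochain.subspace_def cochain_degree_def cochains_def linear_lin cochain_scale_def
      by (auto simp: lin_zero lin_add lin_compose[of "scale _"]) (auto simp: lin_def scale_right_distrib mult.commute)
  next
    fix I :: "nat set" and x j
    assume I: "finite I" "\<And>i. i \<in> I \<Longrightarrow> x i \<in> cochain_degree scale i"
      and sum: "(\<Sum>i\<in>I. x i) = 0" and j: "j \<in> I"
    show "x j = 0"
    proof
      fix xs
      show "x j xs = 0 xs"
      proof (cases "length xs = Suc j")
        case True
        have "0 = (\<Sum>i\<in>I. x i) xs" using sum by simp
        also have "\<dots> = (\<Sum>i\<in>I. x i xs)"
          by (rule additive.sum[of "\<lambda>f. f xs", unfolded additive_def]) simp
        \<comment> \<open>A list of length \<open>Suc j\<close> sees only the component of degree
          \<open>j\<close>.\<close>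
        also have "\<dots> = (\<Sum>i\<in>I. if i = j then x j xs else 0)"
          by (rule sum.cong) (auto simp: cochain_degree_vanish[OF I(2)] True)
        also have "\<dots> = x j xs" using I(1) j by simp
        finally show ?thesis by simp
      qed (simp add: cochain_degree_vanish[OF I(2)[OF j]])
    qed
  qed
qed

sublocale cochain: graded_vector_space "cochain_scale scale" "cochain_degree scale"
  by (rule graded_vector_space_cochain_degree)

lemma total_multilinear:
  assumes "f \<in> cochain.total"
  shows "multilinear f"
  using assms
proof (induction rule: cochain.total_induct)
  case (component i f)
  then show ?case by (blast intro: skew_multilinear_multilinear cochain_degree_skew_multilinear)
next
  case (add f g)
  then show ?case by (simp add: multilinear_def lin_add)
qed

lemma
  shows mn_bracket_add_left: "multilinear Q \<Longrightarrow> mn_bracket scale (P + P') Q = mn_bracket scale P Q + mn_bracket scale P' Q"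
    and mn_bracket_add_right: "multilinear P \<Longrightarrow> mn_bracket scale P (Q + Q') = mn_bracket scale P Q + mn_bracket scale P Q'"
    and mn_bracket_scale_left: "multilinear Q \<Longrightarrow>
      mn_bracket scale (cochain_scale scale c P) Q = cochain_scale scale c (mn_bracket scale P Q)"
    and mn_bracket_scale_right: "multilinear P \<Longrightarrow>
      mn_bracket scale P (cochain_scale scale c Q) = cochain_scale scale c (mn_bracket scale P Q)"
  by (auto simp: mn_bracket_def mn_bracket_hom_def fun_eq_iff cochain_scale_def[of _ _ "mn_bracket _ _ _"]
     mn_circ_add_left mn_circ_add_right mn_circ_scale_left mn_circ_scale_right
     scale_sum_right sum.distrib[symmetric] split_def intro!: sum.cong)
   (auto simp: cochain_scale_def scale_right_distrib scale_right_diff_distrib mult_ac)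

section \<open>Graded skew symmetry and the graded Jacobi identity\<close>

lemma signed_eq_cochain_scale: "cochain_scale scale ((-1) ^ n) f = signed n f"
  by (auto simp: cochain_scale_def scale_minus_one_power signed_def)

lemma signed_cochain_degree: "f \<in> cochain_degree scale p \<Longrightarrow> signed n f \<in> cochain_degree scale p"
  by (simp flip: signed_eq_cochain_scale add: cochain.subspace_scale[OF cochain.subspace_component])

lemma mn_bracket_eq:
  assumes "P \<in> cochain_degree scale p" "Q \<in> cochain_degree scale q"
  shows "mn_bracket scale P Q = mn_circ scale p q P Q - signed (p * q) (mn_circ scale q p Q P)"
  unfolding mn_bracket_homogeneous[OF vector_space_axioms assms] mn_bracket_hom_def signed_eq_cochain_scale ..

lemma mn_bracket_degree:
  assumes "CHAR('k) \<noteq> 2" "P \<in> cochain_degree scale p" "Q \<in> cochain_degree scale q"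
  shows "mn_bracket scale P Q \<in> cochain_degree scale (p + q)"
  unfolding mn_bracket_eq[OF assms(2,3)]
  using mn_circ_cochain_degree[OF assms] mn_circ_cochain_degree[OF assms(1,3,2)]
  by (intro cochain.subspace_diff[OF cochain.subspace_component] signed_cochain_degree) (simp_all add: add.commute)

text \<open>Here \<open>lPQR\<close> stands for (P \<circ> Q) \<circ> R and \<open>rPQR\<close> for
  P \<circ> (Q \<circ> R). The three symmetry relations eliminate three of the \<open>l\<close>
  terms, and what remains cancels for each choice of parities.\<close>

lemma right_symmetric_imp_jacobi:
  fixes lPQR :: "'v::ab_group_add"
  assumes P: "lPRQ - rPRQ = signed (q * r) (lPQR - rPQR)"
    and Q: "lQRP - rQRP = signed (p * r) (lQPR - rQPR)"
    and R: "lRQP - rRQP = signed (p * q) (lRPQ - rRPQ)"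
  shows "rPQR - signed (q * r) rPRQ - signed (p * (q + r)) (lQRP - signed (q * r) lRQP) =
    - signed (r * (p + q)) (rRPQ - signed (p * q) rRQP - signed (r * (p + q)) (lPQR - signed (p * q) lQPR))
    + signed (p * q) (rQPR - signed (p * r) rQRP - signed (q * (p + r)) (lPRQ - signed (p * r) lRPQ))"
proof -
  have l: "lPRQ = rPRQ + signed (q * r) (lPQR - rPQR)" "lQRP = rQRP + signed (p * r) (lQPR - rQPR)"
    "lRQP = rRQP + signed (p * q) (lRPQ - rRPQ)"
    using P Q R by (simp_all add: algebra_simps)
  show ?thesis
    unfolding l
    by (cases "even p"; cases "even q"; cases "even r"; simp add: signed_def algebra_simps)
qed

lemma mn_bracket_jacobi:
  assumes char: "CHAR('k) \<noteq> 2" and P: "P \<in> cochain_degree scale p"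
    and Q: "Q \<in> cochain_degree scale q" and R: "R \<in> cochain_degree scale r"
  shows "mn_bracket scale P (mn_bracket scale Q R) = mn_bracket scale (mn_bracket scale P Q) R
     + signed (p * q) (mn_bracket scale Q (mn_bracket scale P R))"
proof -
  have expand: "mn_bracket scale P (mn_bracket scale Q R) =
      mn_circ scale p (q + r) P (mn_circ scale q r Q R)
      - signed (q * r) (mn_circ scale p (r + q) P (mn_circ scale r q R Q))
      - signed (p * (q + r)) (mn_circ scale (q + r) p (mn_circ scale q r Q R) P
          - signed (q * r) (mn_circ scale (r + q) p (mn_circ scale r q R Q) P))"
    if "P \<in> cochain_degree scale p" "Q \<in> cochain_degree scale q" "R \<in> cochain_degree scale r"
    for P Q R p q r
  proof -
    have right: "additive (mn_circ scale p (q + r) P)"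
      using mn_circ_add_right[OF skew_multilinear_multilinear[OF cochain_degree_skew_multilinear[OF that(1)]]]
      by (simp add: additive_def)
    have left: "additive (\<lambda>A. mn_circ scale (q + r) p A P)"
      by (simp add: additive_def mn_circ_add_left)
    show ?thesis
      by (subst mn_bracket_eq[OF that(1) mn_bracket_degree[OF char that(2,3)]],
          unfold mn_bracket_eq[OF that(2,3)])
        (simp add: additive.diff[OF left] additive.signed[OF left]
          additive.diff[OF right] additive.signed[OF right] add.commute[of r q])
  qed
  \<comment> \<open>Skew symmetry turns the left-nested bracket into a right-nested one, so that the
    single expansion serves all three terms.\<close>
  have left: "mn_bracket scale (mn_bracket scale P Q) R = - signed (r * (p + q)) (mn_bracket scale R (mn_bracket scale P Q))"
    using mn_bracket_eq[OF mn_bracket_degree[OF char P Q] R] mn_bracket_eq[OF R mn_bracket_degree[OF char P Q]]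
    by (auto simp: signed_def mult.commute)
  show ?thesis
    unfolding left expand[OF P Q R] expand[OF R P Q] expand[OF Q P R]
    by (rule right_symmetric_imp_jacobi)
      (rule mn_circ_right_symmetric[OF char] P Q R)+
qed

lemma graded_lie_algebra_mn_bracket:
  assumes char: "CHAR('k) \<noteq> 2"
  shows "graded_lie_algebra (cochain_scale scale) (cochain_degree scale) (mn_bracket scale)"
proof unfold_locales
  show "mn_bracket scale x y = - cochain_scale scale ((- 1) ^ (i * j)) (mn_bracket scale y x)"
    if "x \<in> cochain_degree scale i" "y \<in> cochain_degree scale j" for x y i j
    unfolding signed_eq_cochain_scale mn_bracket_eq[OF that] mn_bracket_eq[OF that(2,1)]
    by (auto simp: signed_def mult.commute)
  show "mn_bracket scale x (mn_bracket scale y z) = mn_bracket scale (mn_bracket scale x y) z +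
      cochain_scale scale ((- 1) ^ (i * j)) (mn_bracket scale y (mn_bracket scale x z))"
    if "x \<in> cochain_degree scale i" "y \<in> cochain_degree scale j" "z \<in> cochain_degree scale k"
    for x y z i j k
    unfolding signed_eq_cochain_scale by (rule mn_bracket_jacobi[OF char that])
qed (simp_all add: mn_bracket_add_left mn_bracket_add_right mn_bracket_scale_left mn_bracket_scale_right
   total_multilinear mn_bracket_degree[OF char])

section \<open>Products as cochains of degree one\<close>

lemma linear_product_lin:
  assumes "bilinear_product scale m"
  shows "lin (m x)" "lin (\<lambda>x. m x y)"
  using assms by (simp_all add: bilinear_product_def linear_lin)

lemma cochain_of_product_degree:
  assumes "CHAR('k) \<noteq> 2" "bilinear_product scale m"
  shows "cochain_of_product m \<in> cochain_degree scale 1"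
proof (rule cochain_degreeI[OF assms(1)])
  show "skew_multilinear (cochain_of_product m)"
    unfolding skew_multilinear_def
  proof (intro conjI allI impI)
    show "lin (\<lambda>v. cochain_of_product m (us @ v # vs))" for us vs
    proof (cases "length us + length vs = 1")
      case True
      then consider y where "us = []" "vs = [y]" | x where "us = [x]" "vs = []"
        by (cases us; cases vs) auto
      then show ?thesis
        by cases (simp_all add: cochain_of_product_def linear_product_lin[OF assms(2)])
    qed (simp add: cochain_of_product_def lin_zero)
  qed (auto simp: cochain_of_product_def)
qed (simp add: cochain_of_product_def)

text \<open>Evaluation of \<open>circ\<close> on two skew arguments. For \<open>m' = m\<close> it
  yields the associator of (x, y, z) minus that of (y, x, z), whose vanishing is left
  symmetry.\<close>

lemma mn_circ_products:
  assumes char: "CHAR('k) \<noteq> 2" and m: "bilinear_product scale m" "bilinear_product scale m'"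
  shows "mn_circ scale 1 1 (cochain_of_product m) (cochain_of_product m') xs =
     (if length xs = 3 then
       m (m' (xs ! 0) (xs ! 1)) (xs ! 2) - m (xs ! 0) (m' (xs ! 1) (xs ! 2))
       - m (m' (xs ! 1) (xs ! 0)) (xs ! 2) + m (xs ! 1) (m' (xs ! 0) (xs ! 2)) else 0)"
proof (cases "length xs = 3")
  case True
  then obtain x y z where xs: "xs = [x, y] @ [z]"
    by (auto simp: numeral_3_eq_3 length_Suc_conv)
  have minus: "m (u - v) w = m u w - m v w" for u v w
    by (rule additive.diff[OF lin_additive[OF linear_product_lin(2)[OF m(1)]]])
  show ?thesis
    using fun_cong[OF fun_cong[OF mn_circ_snoc[OF cochain_of_product_degree[OF char m(1)]
      cochain_of_product_degree[OF char m(2)]]], of "[x, y]" z]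
    unfolding xs
    by (simp add: snoc_def circ_def skew_def cochain_of_product_def minus algebra_simps)
qed (simp add: mn_circ_def)

text \<open>In degree one [P, Q] = P \<circ> Q + Q \<circ> P. The diagonal brackets are therefore
  twice the defect of left symmetry, which may be halved, and the mixed bracket is the compatibility
  expression.\<close>

lemma compatible_pre_lie_algebra_iff:
  assumes char: "CHAR('k) \<noteq> 2" and m: "bilinear_product scale m1" "bilinear_product scale m2"
  shows "compatible_pre_lie_algebra scale m1 m2 \<longleftrightarrow>
     mn_bracket scale (cochain_of_product m1) (cochain_of_product m1) = 0 \<and>
     mn_bracket scale (cochain_of_product m2) (cochain_of_product m2) = 0 \<and>
     mn_bracket scale (cochain_of_product m1) (cochain_of_product m2) = 0"
proof -
  note deg = cochain_of_product_degree[OF char]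
  have bracket: "mn_bracket scale (cochain_of_product m) (cochain_of_product m') = 0 \<longleftrightarrow>
    (\<forall>x y z. m (m' x y) z - m x (m' y z) - m (m' y x) z + m y (m' x z)
       + (m' (m x y) z - m' x (m y z) - m' (m y x) z + m' y (m x z)) = 0)"
    (is "_ \<longleftrightarrow> (\<forall>x y z. ?C x y z = 0)")
    if m: "bilinear_product scale m" "bilinear_product scale m'" for m m'
  proof -
    have eq: "mn_bracket scale (cochain_of_product m) (cochain_of_product m') xs =
      (if length xs = 3 then ?C (xs ! 0) (xs ! 1) (xs ! 2) else 0)" for xs
      unfolding mn_bracket_eq[OF deg[OF m(1)] deg[OF m(2)]]
      by (simp add: mn_circ_products[OF char m(1,2)] mn_circ_products[OF char m(2,1)] signed_def
          del: One_nat_def)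
    have "?C x y z = 0" if "mn_bracket scale (cochain_of_product m) (cochain_of_product m') = 0" for x y z
      using that eq[of "[x, y, z]"] by simp
    then show ?thesis by (auto simp: eq fun_eq_iff)
  qed
  have pre_lie: "pre_lie_algebra scale m \<longleftrightarrow>
    mn_bracket scale (cochain_of_product m) (cochain_of_product m) = 0"
    if "bilinear_product scale m" for m
  proof -
    have "a - b = c - d \<longleftrightarrow> a - b - c + d = 0" for a b c d :: 'g
      unfolding eq_iff_diff_eq_0[of "a - b" "c - d"] by (simp only: diff_diff_eq2 diff_add_eq)
    then show ?thesis
      unfolding bracket[OF that that] double_eq_zero_iff[OF char]
        pre_lie_algebra_def pre_lie_algebra_axioms_def
      using that vector_space_axioms by simp
  qed
  have reorder: "a + a' - b - b' - c - c' + d + d' = a - b - c + d + (a' - b' - c' + d')"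
    for a a' b b' c c' d d' :: 'g
    by (simp add: algebra_simps)
  show ?thesis
    unfolding compatible_pre_lie_algebra_def pre_lie[OF m(1)] pre_lie[OF m(2)]
      bracket[OF m] compatible_pre_lie_algebra_axioms_def reorder ..
qed

end

section \<open>Perturbed compatible pairs as Maurer-Cartan elements\<close>

theorem proposition2p15:
  fixes scale :: "'k::field \<Rightarrow> 'g::ab_group_add \<Rightarrow> 'g"
    and \<pi>1 \<pi>2 :: "'g \<Rightarrow> 'g \<Rightarrow> 'g"
  assumes "CHAR('k) \<noteq> 2"
    and "compatible_pre_lie_algebra scale \<pi>1 \<pi>2"
  shows "bidifferential_graded_lie_algebra (cochain_scale scale) (cochain_degree scale)
           (mn_bracket scale)
           (mn_bracket scale (cochain_of_product \<pi>1))
           (mn_bracket scale (cochain_of_product \<pi>2)) \<and>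
         (\<forall>\<pi>1' \<pi>2'. bilinear_product scale \<pi>1' \<and> bilinear_product scale \<pi>2' \<longrightarrow>
           (compatible_pre_lie_algebra scale
              (\<lambda>x y. \<pi>1 x y + \<pi>1' x y) (\<lambda>x y. \<pi>2 x y + \<pi>2' x y) \<longleftrightarrow>
            maurer_cartan_pair (cochain_scale scale) (cochain_degree scale)
              (mn_bracket scale)
              (mn_bracket scale (cochain_of_product \<pi>1))
              (mn_bracket scale (cochain_of_product \<pi>2))
              (cochain_of_product \<pi>1') (cochain_of_product \<pi>2')))"
proof -
  interpret pi: compatible_pre_lie_algebra scale \<pi>1 \<pi>2 by (rule assms(2))
  interpret C: cochain_space scale
    by (simp add: cochain_space_def pi.first.vector_space_axioms)
  interpret L: graded_lie_algebra "cochain_scale scale" "cochain_degree scale" "mn_bracket scale"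
    by (rule C.graded_lie_algebra_mn_bracket[OF assms(1)])
  note deg = C.cochain_of_product_degree[OF assms(1)]
  have flat: "mn_bracket scale (cochain_of_product \<pi>1) (cochain_of_product \<pi>1) = 0"
    "mn_bracket scale (cochain_of_product \<pi>2) (cochain_of_product \<pi>2) = 0"
    "mn_bracket scale (cochain_of_product \<pi>1) (cochain_of_product \<pi>2) = 0"
    using C.compatible_pre_lie_algebra_iff[OF assms(1) pi.first.bilinear pi.second.bilinear] assms(2) by auto
  \<comment> \<open>Passing from products to cochains is additive, so the perturbed products become
    the elements p + P and q + Q of \<open>maurer_cartan_pair_iff\<close>.\<close>
  have sum: "bilinear_product scale (\<lambda>x y. m x y + m' x y)"
    "cochain_of_product (\<lambda>x y. m x y + m' x y) = cochain_of_product m + cochain_of_product m'"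
    if "bilinear_product scale m" "bilinear_product scale m'" for m m'
    using that by (auto simp: bilinear_product_def C.linear_lin C.lin_add cochain_of_product_def fun_eq_iff)
  show ?thesis
  proof (intro conjI allI impI; (elim conjE)?)
    show "bidifferential_graded_lie_algebra (cochain_scale scale) (cochain_degree scale)
      (mn_bracket scale) (mn_bracket scale (cochain_of_product \<pi>1)) (mn_bracket scale (cochain_of_product \<pi>2))"
      by (rule L.br_bidifferential[OF assms(1) deg[OF pi.first.bilinear] flat(1) deg[OF pi.second.bilinear] flat(2,3)])
  next
    fix \<pi>1' \<pi>2' assume \<pi>': "bilinear_product scale \<pi>1'" "bilinear_product scale \<pi>2'"
    show "compatible_pre_lie_algebra scale (\<lambda>x y. \<pi>1 x y + \<pi>1' x y) (\<lambda>x y. \<pi>2 x y + \<pi>2' x y) \<longleftrightarrow>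
      maurer_cartan_pair (cochain_scale scale) (cochain_degree scale) (mn_bracket scale)
        (mn_bracket scale (cochain_of_product \<pi>1)) (mn_bracket scale (cochain_of_product \<pi>2))
        (cochain_of_product \<pi>1') (cochain_of_product \<pi>2')"
      \<comment> \<open>Both sides become the vanishing of the same three brackets at the perturbed
        elements.\<close>
      unfolding L.maurer_cartan_pair_iff[OF assms(1) deg[OF pi.first.bilinear] flat(1)
          deg[OF pi.second.bilinear] flat(2,3) deg[OF \<pi>'(1)] deg[OF \<pi>'(2)]]
        C.compatible_pre_lie_algebra_iff[OF assms(1) sum(1)[OF pi.first.bilinear \<pi>'(1)]
          sum(1)[OF pi.second.bilinear \<pi>'(2)]]
        sum(2)[OF pi.first.bilinear \<pi>'(1)] sum(2)[OF pi.second.bilinear \<pi>'(2)] ..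
  qed
qed

end
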